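(* Let $\Lambda\ge\lambda>0$ and let $M,E>0$ be constants. Suppose $A(x,t)=(a^{ij}(x,t))_{i,j=1}^n$ is a real symmetric matrix-valued function on $\mathbb{R}^n\times(0,2)$ such that for all $(x,t)\in\mathbb{R}^n\times(0,2)$ $$\lambda|\xi|^2\le\sum_{i,j}a^{ij}(x,t)\xi_i\xi_j\le\Lambda|\xi|^2\quad\forall\,\xi\in\mathbb{R}^n,$$ $$|\nabla_xa^{ij}(x,t)|+|\partial_ta^{ij}(x,t)|\le M,\qquad|\nabla_xa^{ij}(x,t)|\le\frac{E}{|x|}.$$ Let $P=\partial_t+\sum_{i,j}\partial_i(a^{ij}\partial_j)$. Then there exists a constant $K=K(n,\Lambda,\lambda,M,E)$, depending only on $n,\Lambda,\lambda,M,E$, such that for any $u\in C_0^\infty(\mathbb{R}^n\times(0,2))$ and any number $\gamma>0$, $$\int_{\mathbb{R}^n\times(0,2)}e^{2\gamma(t^{-K}-1)-\frac{b|x|^2+K}{t}}\left(|u|^2+|\nabla u|^2\right)dx\,dt\le\int_{\mathbb{R}^n\times(0,2)}e^{2\gamma(t^{-K}-1)-\frac{b|x|^2+K}{t}}|Pu|^2\,dx\,dt,$$ where $b=\frac{1}{8\Lambda}$.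
   Context: $\nabla=\nabla_x$ is the gradient in the space variable $x$, $\partial_i=\partial/\partial x_i$. The coefficients $a^{ij}$ are Lipschitz and the bounds on their first derivatives are understood accordingly (i.e. almost everywhere). $C_0^\infty$ denotes smooth functions with compact support. *)

theory Defs
  imports "HOL-Analysis.Analysis"
begin

text \<open>Points of space-time are pairs \<open>(x, t)\<close> of type \<open>(real^'n) \<times> real\<close>.\<close>

definition dir_deriv :: "'a::real_normed_vector \<Rightarrow> ('a \<Rightarrow> real) \<Rightarrow> 'a \<Rightarrow> real" where
  "dir_deriv v f p = deriv (\<lambda>s. f (p + s *\<^sub>R v)) 0"

definition d_x :: "'n::finite \<Rightarrow> ((real^'n) \<times> real \<Rightarrow> real) \<Rightarrow> (real^'n) \<times> real \<Rightarrow> real" where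
  "d_x i = dir_deriv (axis i 1, 0)"

definition d_t :: "((real^'n::finite) \<times> real \<Rightarrow> real) \<Rightarrow> (real^'n) \<times> real \<Rightarrow> real" where
  "d_t = dir_deriv (0, 1)"

definition grad_x :: "((real^'n::finite) \<times> real \<Rightarrow> real) \<Rightarrow> (real^'n) \<times> real \<Rightarrow> real^'n" where
  "grad_x f p = (\<chi> i. d_x i f p)"

definition slab :: "((real^'n::finite) \<times> real) set" where
  "slab = UNIV \<times> {0<..<2}"

text \<open>\<open>C\<^sup>\<infinity>\<close>: every iterated partial derivative, of any order \<open>length vs\<close> and in any coordinate
  directions \<open>vs\<close>, exists and is (Frechet) differentiable, hence continuous, everywhere.\<close>

definition C_infinity :: "('a::euclidean_space \<Rightarrow> real) \<Rightarrow> bool" where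
  "C_infinity f \<longleftrightarrow> (\<forall>vs. set vs \<subseteq> Basis \<longrightarrow> foldr dir_deriv vs f differentiable_on UNIV)"

text \<open>Elements of \<open>C\<^sub>0\<^sup>\<infinity>(S)\<close>, for open \<open>S\<close>, are represented by their extension by zero to
  the whole space.\<close>

definition C0_infinity :: "'a::euclidean_space set \<Rightarrow> ('a \<Rightarrow> real) set" where
  "C0_infinity S = {u. C_infinity u \<and> compact (closure (support_on UNIV u))
                       \<and> closure (support_on UNIV u) \<subseteq> S}"

definition uniformly_elliptic ::
  "real \<Rightarrow> real \<Rightarrow> ((real^'n::finite) \<times> real \<Rightarrow> real^'n^'n) \<Rightarrow> bool" where
  "uniformly_elliptic lam Lam A \<longleftrightarrow>
     (\<forall>p\<in>slab. \<forall>\<xi>::real^'n.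
        lam * (norm \<xi>)\<^sup>2 \<le> (\<Sum>i\<in>UNIV. \<Sum>j\<in>UNIV. A p $ i $ j * \<xi> $ i * \<xi> $ j) \<and>
        (\<Sum>i\<in>UNIV. \<Sum>j\<in>UNIV. A p $ i $ j * \<xi> $ i * \<xi> $ j) \<le> Lam * (norm \<xi>)\<^sup>2)"

text \<open>The bounds on the first derivatives of the Lipschitz entries hold almost everywhere.
  Requiring differentiability at the same points only rules out the arbitrary values of
  \<^const>\<open>deriv\<close>; by Rademacher's theorem it is no restriction. The line \<open>x = 0\<close>, where
  \<open>E / norm x\<close> is \<open>0\<close> by convention, is a null set.\<close>

definition coeff_derivative_bounds ::
  "real \<Rightarrow> real \<Rightarrow> ((real^'n::finite) \<times> real \<Rightarrow> real^'n^'n) \<Rightarrow> bool" where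
  "coeff_derivative_bounds M E A \<longleftrightarrow>
     (\<forall>i j. (\<exists>L. L-lipschitz_on slab (\<lambda>p. A p $ i $ j)) \<and>
        (AE p in lebesgue. p \<in> slab \<longrightarrow>
           (\<lambda>q. A q $ i $ j) differentiable (at p) \<and>
           norm (grad_x (\<lambda>q. A q $ i $ j) p) + \<bar>d_t (\<lambda>q. A q $ i $ j) p\<bar> \<le> M \<and>
           norm (grad_x (\<lambda>q. A q $ i $ j) p) \<le> E / norm (fst p)))"

definition parabolic_op ::
  "((real^'n::finite) \<times> real \<Rightarrow> real^'n^'n) \<Rightarrow> ((real^'n) \<times> real \<Rightarrow> real) \<Rightarrow> (real^'n) \<times> real \<Rightarrow> real" where
  "parabolic_op A u p =
     d_t u p + (\<Sum>i\<in>UNIV. \<Sum>j\<in>UNIV. d_x i (\<lambda>q. A q $ i $ j * d_x j u q) p)"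

definition carleman_weight ::
  "real \<Rightarrow> real \<Rightarrow> real \<Rightarrow> (real^'n::finite) \<times> real \<Rightarrow> real" where
  "carleman_weight b K \<gamma> = (\<lambda>(x, t).
     exp (2 * \<gamma> * (t powr (- K) - 1) - (b * (norm x)\<^sup>2 + K) / t))"

end

theory Submission
  imports Defs
begin

text \<open>Put \<open>\<phi> = \<gamma> (t powr (- K) - 1) - (b |x|\<^sup>2 + K) / (2 t)\<close>, so that the weight is \<open>e\<close> to the power
  \<open>2 \<phi>\<close>, and \<open>v = e\<^bsup>\<phi>\<^esup> u\<close>. With \<open>\<beta> = A \<nabla>\<phi>\<close> and \<open>q = \<beta> \<cdot> \<nabla>\<phi> - \<partial>\<^sub>t \<phi>\<close>,
  \<open>e\<^bsup>\<phi>\<^esup> P u = [div (A \<nabla>v) + q v] + [\<partial>\<^sub>t v - 2 \<beta> \<cdot> \<nabla>v - f v] + (f - div \<beta>) v\<close>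
  for every function \<open>f\<close>. Choosing \<open>f = k\<^sub>1 / t\<close> instead of \<open>f = div \<beta>\<close> avoids second derivatives of
  \<open>A\<close>, and for large \<open>k\<^sub>1\<close> makes the commutator of the two brackets positive: since \<open>|x| |\<nabla>A| \<le> E\<close>, all
  unsigned terms are at most of size \<open>|\<nabla>v|\<^sup>2 / t\<close>, \<open>b |x|\<^sup>2 v\<^sup>2 / t\<^sup>3\<close>,
  and these are absorbed by \<open>2 f A \<nabla>v \<cdot> \<nabla>v\<close> and \<open>- 2 f q v\<^sup>2\<close>; the latter has the right
  sign because \<open>b = 1 / (8 \<Lambda>)\<close>. The terms \<open>K / t\<close> and
  \<open>\<gamma> t powr (- K)\<close> of the weight then control the error \<open>(f - div \<beta>)\<^sup>2 v\<^sup>2\<close> and the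
  contribution of \<open>\<gamma>\<close> to \<open>- 2 f q v\<^sup>2\<close>, once \<open>K\<close> is large compared with \<open>k\<^sub>1\<close>.

  The integrations by parts are packed into one pointwise identity modulo the space-time divergence of
  a compactly supported Lipschitz field, whose integral vanishes.\<close>

subsection \<open>Directional derivatives of Lipschitz functions\<close>

text \<open>A relation in place of \<open>dir_deriv\<close>, whose value is arbitrary where the
  derivative does not exist. It asks for differentiability along one line only, so fields can be
  treated at single points.\<close>

definition has_dir_deriv :: "('a::real_normed_vector \<Rightarrow> real) \<Rightarrow> real \<Rightarrow> 'a \<Rightarrow> 'a \<Rightarrow> bool" where
  "has_dir_deriv f D v p \<longleftrightarrow> ((\<lambda>s. f (p + s *\<^sub>R v)) has_real_derivative D) (at 0)"

lemma dir_deriv_eqI: "has_dir_deriv f D v p \<Longrightarrow> dir_deriv v f p = D"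
  unfolding has_dir_deriv_def dir_deriv_def by (rule DERIV_imp_deriv)

text \<open>The complement of \<open>S\<close> is open, so outside the support this provides genuine
  derivatives of value 0 without any regularity of \<open>f\<close>.\<close>

lemma has_dir_deriv_local_zero:
  fixes f :: "'a::real_normed_vector \<Rightarrow> real"
  assumes "closed S" "p \<notin> S" "\<And>q. q \<notin> S \<Longrightarrow> f q = 0"
  shows "has_dir_deriv f 0 v p"
proof -
  have "((\<lambda>s. p + s *\<^sub>R v) \<longlongrightarrow> p + 0 *\<^sub>R v) (nhds (0::real))"
    by (intro tendsto_intros filterlim_ident)
  moreover have "\<forall>\<^sub>F q in nhds (p + 0 *\<^sub>R v). q \<in> - S"
    using assms by (intro eventually_nhds_in_open) auto
  ultimately have "\<forall>\<^sub>F s in nhds (0::real). p + s *\<^sub>R v \<in> - S"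
    by (rule eventually_compose_filterlim[rotated])
  hence "\<forall>\<^sub>F s in nhds (0::real). f (p + s *\<^sub>R v) = 0"
    by eventually_elim (use assms in auto)
  thus ?thesis
    unfolding has_dir_deriv_def by (rule DERIV_cong_ev[THEN iffD2, OF refl _ refl]) (rule DERIV_const)
qed

text \<open>A segment from inside \<open>Q\<close> to outside meets the frontier of
  \<open>Q\<close>, where \<open>f\<close> already vanishes, so the constant on \<open>Q\<close>
  also serves across the boundary. This extends estimates from a box in the slab, where
  \<open>A\<close> is controlled, to the whole space.\<close>

lemma lipschitz_on_UNIV_if_zero_outside:
  fixes f :: "'a::euclidean_space \<Rightarrow> real"
  assumes "L-lipschitz_on Q f" "closed Q" "S \<subseteq> interior Q" "\<And>q. q \<notin> S \<Longrightarrow> f q = 0"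
  shows "L-lipschitz_on UNIV f"
proof -
  have L: "0 \<le> L" using assms(1) by (rule lipschitz_on_nonneg)
  have mixed: "\<bar>f x - f y\<bar> \<le> L * dist x y" if "x \<in> Q" "y \<notin> Q" for x y
  proof -
    have "closed_segment x y \<inter> frontier Q \<noteq> {}"
      using that by (intro connected_Int_frontier) auto
    then obtain z where z: "z \<in> closed_segment x y" "z \<in> frontier Q" by auto
    have "z \<in> Q" using z(2) assms(2) by (auto simp: frontier_def)
    have "f z = 0" "f y = 0"
      using z(2) that(2) assms(3) interior_subset by (auto intro!: assms(4) simp: frontier_def)
    hence "\<bar>f x - f y\<bar> = dist (f x) (f z)" by (simp add: dist_real_def)
    also have "\<dots> \<le> L * dist x z"
      using assms(1) \<open>x \<in> Q\<close> \<open>z \<in> Q\<close> by (rule lipschitz_onD)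
    also have "\<dots> \<le> L * dist x y"
      using dist_in_closed_segment[OF z(1)] L by (intro mult_left_mono) (auto simp: dist_commute)
    finally show ?thesis .
  qed
  show ?thesis
  proof (rule lipschitz_onI[OF _ L])
    fix x y
    show "dist (f x) (f y) \<le> L * dist x y"
    proof -
      consider "x \<in> Q" "y \<in> Q" | "x \<in> Q" "y \<notin> Q" | "x \<notin> Q" "y \<in> Q" | "x \<notin> Q" "y \<notin> Q"
        by blast
      thus ?thesis
      proof cases
        case 1
        thus ?thesis using assms(1) by (intro lipschitz_onD)
      next
        case 2
        thus ?thesis using mixed[of x y] by (simp add: dist_real_def)
      next
        case 3
        thus ?thesis using mixed[of y x] by (simp add: dist_real_def dist_commute abs_minus_commute)
      next
        case 4
        hence "x \<notin> S" "y \<notin> S" using assms(3) interior_subset[of Q] by auto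
        thus ?thesis using L by (simp add: assms(4))
      qed
    qed
  qed
qed

text \<open>Completeness of Lebesgue measure: the two preimages differ by a null set. It covers
  derivatives that are only almost everywhere a limit of Borel functions.\<close>

lemma borel_measurable_lebesgue_AE_eq:
  fixes f g :: "'a::euclidean_space \<Rightarrow> real"
  assumes "g \<in> borel_measurable lebesgue" "AE x in lebesgue. f x = g x"
  shows "f \<in> borel_measurable lebesgue"
proof (rule measurableI)
  fix B :: "real set" assume "B \<in> sets borel"
  hence "g -` B \<inter> space lebesgue \<in> sets lebesgue"
    using assms(1) by (rule measurable_sets[rotated])
  moreover have "AE x in lebesgue. x \<in> g -` B \<inter> space lebesgue \<longleftrightarrow> x \<in> f -` B \<inter> space lebesgue"
    using assms(2) by eventually_elim auto
  ultimately show "f -` B \<inter> space lebesgue \<in> sets lebesgue"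
    using completion.in_sets_AE by (metis Int_lower2)
qed auto

lemma lebesgue_integral_shift:
  fixes f :: "'a::euclidean_space \<Rightarrow> real"
  assumes "f \<in> borel_measurable borel"
  shows "(\<integral>x. f (x + c) \<partial>lborel) = (\<integral>x. f x \<partial>lborel)"
proof -
  have "(\<integral>x. f x \<partial>lborel) = (\<integral>x. f x \<partial>distr lborel borel ((+) c))"
    by (simp add: lborel_distr_plus)
  also have "\<dots> = (\<integral>x. f (c + x) \<partial>lborel)"
    using assms by (subst integral_distr) auto
  finally show ?thesis by (simp add: add.commute)
qed

text \<open>The difference quotients have integral zero by translation invariance and are dominated by
  the Lipschitz constant on a fixed ball.\<close>

lemma lipschitz_compact_support_dir_deriv:
  fixes w :: "'a::euclidean_space \<Rightarrow> real"
  assumes L: "L-lipschitz_on UNIV w" and S: "compact S" and supp: "\<And>q. q \<notin> S \<Longrightarrow> w q = 0"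
    and ae: "AE p in lebesgue. p \<in> S \<longrightarrow> (\<exists>D. has_dir_deriv w D v p)"
  shows integrable_dir_deriv: "integrable lebesgue (dir_deriv v w)"
    and integral_dir_deriv: "(\<integral>p. dir_deriv v w p \<partial>lebesgue) = 0"
    and bounded_dir_deriv: "AE p in lebesgue. \<bar>dir_deriv v w p\<bar> \<le> L * norm v"
proof -
  define s where "s n p = real (Suc n) * (w (p + (1 / real (Suc n)) *\<^sub>R v) - w p)" for n p
  have L0: "0 \<le> L" using L by (rule lipschitz_on_nonneg)
  have cont: "continuous_on UNIV w" using L by (rule lipschitz_on_continuous_on)
  hence wm[measurable]: "w \<in> borel_measurable borel" by (rule borel_measurable_continuous_onI)
  obtain R where R: "S \<subseteq> cball 0 R" "R > 0"
    using bounded_subset_ballD[OF compact_imp_bounded[OF S], of 0] ball_subset_cball by blast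
  \<comment> \<open>Dominating function: the steps \<open>1 / real (Suc n)\<close> are at most 1, so
    every difference quotient vanishes outside the ball enlarged by \<open>norm v\<close>.\<close>
  define b where "b p = L * norm v * indicat_real (cball 0 (R + norm v)) p" for p :: 'a
  have ib: "integrable lborel b"
    unfolding b_def by (intro integrable_mult_right integrable_real_indicator)
      (use emeasure_lborel_cball_finite[of 0 "R + norm v"] in auto)
  have sm: "s n \<in> borel_measurable lborel" for n unfolding s_def by simp
  have bound: "\<bar>s n p\<bar> \<le> b p" for n p
  proof (cases "norm p \<le> R + norm v")
    case True
    have "dist (w (p + (1 / real (Suc n)) *\<^sub>R v)) (w p) \<le> L * dist (p + (1 / real (Suc n)) *\<^sub>R v) p"
      using L by (rule lipschitz_onD) auto
    also have "\<dots> = L * (norm v / real (Suc n))" by (simp add: dist_norm)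
    finally have "real (Suc n) * \<bar>w (p + (1 / real (Suc n)) *\<^sub>R v) - w p\<bar> \<le> real (Suc n) * (L * (norm v / real (Suc n)))"
      by (intro mult_left_mono) (auto simp: dist_real_def)
    thus ?thesis using True by (simp add: s_def b_def abs_mult)
  next
    case False
    have "norm v / real (Suc n) \<le> norm v"
      by (simp add: field_simps mult_le_cancel_left1)
    moreover have "norm p \<le> norm (p + (1 / real (Suc n)) *\<^sub>R v) + norm v / real (Suc n)"
      using norm_triangle_ineq4[of "p + (1 / real (Suc n)) *\<^sub>R v" "(1 / real (Suc n)) *\<^sub>R v"] by simp
    ultimately have "norm (p + (1 / real (Suc n)) *\<^sub>R v) > R" "norm p > R"
      using False norm_ge_zero[of v] by linarith+
    hence "w (p + (1 / real (Suc n)) *\<^sub>R v) = 0" "w p = 0"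
      using R by (auto intro!: supp)
    thus ?thesis using L0 by (simp add: s_def b_def)
  qed
  have ae2: "AE p in lebesgue. has_dir_deriv w (dir_deriv v w p) v p"
    using ae
  proof eventually_elim
    case (elim p)
    show ?case
    proof (cases "p \<in> S")
      case False
      have "has_dir_deriv w 0 v p"
        using compact_imp_closed[OF S] False supp by (rule has_dir_deriv_local_zero)
      thus ?thesis by (simp add: dir_deriv_eqI)
    qed (use elim dir_deriv_eqI in blast)
  qed
  have lims: "(\<lambda>n. s n p) \<longlonglongrightarrow> dir_deriv v w p" if "has_dir_deriv w (dir_deriv v w p) v p" for p
  proof -
    have "((\<lambda>h. (w (p + h *\<^sub>R v) - w p) / h) \<longlongrightarrow> dir_deriv v w p) (at 0)"
      using that by (simp add: has_dir_deriv_def has_field_derivative_iff)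
    moreover have "filterlim (\<lambda>n. 1 / real (Suc n)) (at 0) sequentially"
      using LIMSEQ_inverse_real_of_nat
      by (auto simp: filterlim_at inverse_eq_divide)
    ultimately have "(\<lambda>n. (w (p + (1 / real (Suc n)) *\<^sub>R v) - w p) / (1 / real (Suc n))) \<longlonglongrightarrow> dir_deriv v w p"
      by (rule filterlim_compose)
    thus ?thesis by (simp add: s_def mult.commute)
  qed
  have aelim: "AE p in lebesgue. (\<lambda>n. s n p) \<longlonglongrightarrow> dir_deriv v w p"
    using ae2 by eventually_elim (rule lims)
  \<comment> \<open>\<open>g\<close> is defined everywhere through \<open>lim\<close>, hence Borel
    measurable even where the quotients may diverge; the derivative agrees with it almost
    everywhere.\<close>
  define g where "g p = lim (\<lambda>n. s n p)" for p
  have gm: "g \<in> borel_measurable lborel" unfolding g_def by (rule borel_measurable_lim_metric) (use sm in auto)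
  have eq: "AE p in lebesgue. dir_deriv v w p = g p"
    using aelim by eventually_elim (simp add: g_def limI)
  have m: "dir_deriv v w \<in> borel_measurable lebesgue"
    using measurable_completion[OF gm] eq by (rule borel_measurable_lebesgue_AE_eq)
  have sml: "s n \<in> borel_measurable lebesgue" for n using sm by (rule measurable_completion)
  have ibl: "integrable lebesgue b" using ib
    by (simp add: integrable_completion borel_measurable_integrable)
  show "integrable lebesgue (dir_deriv v w)"
    by (rule integrable_dominated_convergence[OF m sml ibl aelim]) (use bound in auto)
  have "(\<lambda>n. \<integral>p. s n p \<partial>lebesgue) \<longlonglongrightarrow> (\<integral>p. dir_deriv v w p \<partial>lebesgue)"
    by (rule integral_dominated_convergence[OF m sml ibl aelim]) (use bound in auto)
  moreover have "(\<integral>p. s n p \<partial>lebesgue) = 0" for n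
  proof -
    have iw: "integrable lborel w"
    proof -
      have "integrable lborel (\<lambda>x. indicator S x *\<^sub>R w x)"
        by (rule borel_integrable_compact[OF S]) (use cont continuous_on_subset in blast)
      also have "(\<lambda>x. indicator S x *\<^sub>R w x) = w"
      proof
        fix x show "indicator S x *\<^sub>R w x = w x" by (cases "x \<in> S") (auto simp: supp)
      qed
      finally show ?thesis .
    qed
    have iw2: "integrable lborel (\<lambda>p. w (p + c))" for c
    proof -
      have "integrable (distr lborel borel ((+) c)) w" using iw by (simp add: lborel_distr_plus)
      hence "integrable lborel (\<lambda>p. w (c + p))" by (subst (asm) integrable_distr_eq) auto
      thus ?thesis by (simp add: add.commute)
    qed
    have "(\<integral>p. s n p \<partial>lborel) = 0"
      unfolding s_def by (simp add: iw iw2 lebesgue_integral_shift)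
    thus ?thesis using sm by (simp add: integral_completion)
  qed
  ultimately show "(\<integral>p. dir_deriv v w p \<partial>lebesgue) = 0"
    by (simp add: LIMSEQ_const_iff)
  show "AE p in lebesgue. \<bar>dir_deriv v w p\<bar> \<le> L * norm v"
    using aelim
  proof eventually_elim
    case (elim p)
    hence "(\<lambda>n. \<bar>s n p\<bar>) \<longlonglongrightarrow> \<bar>dir_deriv v w p\<bar>" by (rule tendsto_rabs)
    moreover have "\<bar>s n p\<bar> \<le> L * norm v" for n
      using bound[of n p] L0 by (auto simp: b_def indicator_def split: if_splits intro: order.trans)
    ultimately show ?case by (intro LIMSEQ_le_const2) auto
  qed
qed

section \<open>Symmetry of mixed second directional derivatives\<close>

lemma has_dir_deriv_along:
  assumes "has_dir_deriv f D v (p + s *\<^sub>R v)"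
  shows "((\<lambda>s. f (p + s *\<^sub>R v)) has_real_derivative D) (at s)"
proof -
  have "((\<lambda>x. f (p + (x + s) *\<^sub>R v)) has_real_derivative D) (at 0)"
    using assms by (simp add: has_dir_deriv_def algebra_simps)
  thus ?thesis using DERIV_shift[of "\<lambda>s. f (p + s *\<^sub>R v)" D 0 s] by simp
qed

text \<open>Mean value theorem twice: along \<open>a\<close> for the increment of \<open>f\<close>
  over the step \<open>h\<close> in direction \<open>b\<close>, then along \<open>b\<close> for
  \<open>fa\<close>.\<close>

lemma second_difference_mean_value:
  fixes f :: "'a::real_normed_vector \<Rightarrow> real"
  assumes fa: "\<And>p. has_dir_deriv f (fa p) a p" and fab: "\<And>p. has_dir_deriv fa (fab p) b p"
    and h: "0 < h"
  obtains s t where "0 < s" "s < h" "0 < t" "t < h"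
    "f (p + h *\<^sub>R a + h *\<^sub>R b) - f (p + h *\<^sub>R a) - f (p + h *\<^sub>R b) + f p = h * h * fab (p + s *\<^sub>R a + t *\<^sub>R b)"
proof -
  define g where "g s = f (p + h *\<^sub>R b + s *\<^sub>R a) - f (p + s *\<^sub>R a)" for s
  have "DERIV g x :> fa (p + h *\<^sub>R b + x *\<^sub>R a) - fa (p + x *\<^sub>R a)" for x
    unfolding g_def by (intro DERIV_diff has_dir_deriv_along fa)
  hence "\<exists>z. 0 < z \<and> z < h \<and> g h - g 0 = (h - 0) * (fa (p + h *\<^sub>R b + z *\<^sub>R a) - fa (p + z *\<^sub>R a))"
    using h by (intro MVT2) auto
  then obtain s where s: "0 < s" "s < h"
    "g h - g 0 = h * (fa (p + h *\<^sub>R b + s *\<^sub>R a) - fa (p + s *\<^sub>R a))" by auto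
  have "DERIV (\<lambda>t. fa (p + s *\<^sub>R a + t *\<^sub>R b)) x :> fab (p + s *\<^sub>R a + x *\<^sub>R b)" for x
    by (intro has_dir_deriv_along fab)
  hence "\<exists>z. 0 < z \<and> z < h \<and> fa (p + s *\<^sub>R a + h *\<^sub>R b) - fa (p + s *\<^sub>R a + 0 *\<^sub>R b)
      = (h - 0) * fab (p + s *\<^sub>R a + z *\<^sub>R b)"
    using h by (intro MVT2) auto
  then obtain t where t: "0 < t" "t < h"
    "fa (p + s *\<^sub>R a + h *\<^sub>R b) - fa (p + s *\<^sub>R a) = h * fab (p + s *\<^sub>R a + t *\<^sub>R b)" by auto
  have "g h - g 0 = h * h * fab (p + s *\<^sub>R a + t *\<^sub>R b)"
    using s(3) t(3) by (simp add: add_ac)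
  moreover have "g h - g 0 = f (p + h *\<^sub>R a + h *\<^sub>R b) - f (p + h *\<^sub>R a) - f (p + h *\<^sub>R b) + f p"
    by (simp add: g_def add_ac)
  ultimately show ?thesis using that s(1,2) t(1,2) by auto
qed

text \<open>The second difference is symmetric in \<open>a\<close> and \<open>b\<close>, so
  \<open>fab\<close> and \<open>fba\<close> take equal values at two points that tend to
  \<open>p\<close> with \<open>h\<close>; continuity at \<open>p\<close> finishes.\<close>

lemma mixed_dir_derivs_commute:
  fixes f :: "'a::real_normed_vector \<Rightarrow> real"
  assumes fa: "\<And>p. has_dir_deriv f (fa p) a p" and fab: "\<And>p. has_dir_deriv fa (fab p) b p"
    and fb: "\<And>p. has_dir_deriv f (fb p) b p" and fba: "\<And>p. has_dir_deriv fb (fba p) a p"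
    and cont: "isCont fab p" "isCont fba p"
  shows "fab p = fba p"
proof -
  have "\<exists>s t s' t'. 0 < s \<and> s < h \<and> 0 < t \<and> t < h \<and> 0 < s' \<and> s' < h \<and> 0 < t' \<and> t' < h \<and>
      fab (p + s *\<^sub>R a + t *\<^sub>R b) = fba (p + s' *\<^sub>R b + t' *\<^sub>R a)" if h: "0 < h" for h
  proof -
    obtain s t where 1: "0 < s" "s < h" "0 < t" "t < h"
      "f (p + h *\<^sub>R a + h *\<^sub>R b) - f (p + h *\<^sub>R a) - f (p + h *\<^sub>R b) + f p = h * h * fab (p + s *\<^sub>R a + t *\<^sub>R b)"
      using second_difference_mean_value[OF fa fab h] .
    obtain s' t' where 2: "0 < s'" "s' < h" "0 < t'" "t' < h"
      "f (p + h *\<^sub>R b + h *\<^sub>R a) - f (p + h *\<^sub>R b) - f (p + h *\<^sub>R a) + f p = h * h * fba (p + s' *\<^sub>R b + t' *\<^sub>R a)"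
      using second_difference_mean_value[OF fb fba h] .
    have "h * h * fab (p + s *\<^sub>R a + t *\<^sub>R b) = h * h * fba (p + s' *\<^sub>R b + t' *\<^sub>R a)"
      unfolding 1(5)[symmetric] 2(5)[symmetric] by (simp add: add_ac)
    hence "fab (p + s *\<^sub>R a + t *\<^sub>R b) = fba (p + s' *\<^sub>R b + t' *\<^sub>R a)" using h by simp
    thus ?thesis using 1 2 by blast
  qed
  hence "\<forall>n. \<exists>s t s' t'. 0 < s \<and> s < 1 / real (Suc n) \<and> 0 < t \<and> t < 1 / real (Suc n) \<and>
      0 < s' \<and> s' < 1 / real (Suc n) \<and> 0 < t' \<and> t' < 1 / real (Suc n) \<and>
      fab (p + s *\<^sub>R a + t *\<^sub>R b) = fba (p + s' *\<^sub>R b + t' *\<^sub>R a)" by simp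
  then obtain s t s' t' where st: "\<And>n. 0 < s n \<and> s n < 1 / real (Suc n) \<and> 0 < t n \<and> t n < 1 / real (Suc n) \<and>
      0 < s' n \<and> s' n < 1 / real (Suc n) \<and> 0 < t' n \<and> t' n < 1 / real (Suc n) \<and>
      fab (p + s n *\<^sub>R a + t n *\<^sub>R b) = fba (p + s' n *\<^sub>R b + t' n *\<^sub>R a)" by metis
  have lim: "g \<longlonglongrightarrow> 0" if "\<And>n. 0 < g n \<and> g n < 1 / real (Suc n)" for g :: "nat \<Rightarrow> real"
    by (rule tendsto_sandwich[OF _ _ tendsto_const LIMSEQ_inverse_real_of_nat])
      (use that in \<open>auto intro!: always_eventually less_imp_le simp: inverse_eq_divide\<close>)
  have "s \<longlonglongrightarrow> 0" "t \<longlonglongrightarrow> 0" "s' \<longlonglongrightarrow> 0" "t' \<longlonglongrightarrow> 0" using st by (auto intro: lim)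
  note st0 = this
  have "(\<lambda>n. p + s n *\<^sub>R a + t n *\<^sub>R b) \<longlonglongrightarrow> p + 0 *\<^sub>R a + 0 *\<^sub>R b"
    by (intro tendsto_intros st0)
  moreover have "(\<lambda>n. p + s' n *\<^sub>R b + t' n *\<^sub>R a) \<longlonglongrightarrow> p + 0 *\<^sub>R b + 0 *\<^sub>R a"
    by (intro tendsto_intros st0)
  ultimately have "(\<lambda>n. p + s n *\<^sub>R a + t n *\<^sub>R b) \<longlonglongrightarrow> p"
    "(\<lambda>n. p + s' n *\<^sub>R b + t' n *\<^sub>R a) \<longlonglongrightarrow> p" by auto
  hence "(\<lambda>n. fab (p + s n *\<^sub>R a + t n *\<^sub>R b)) \<longlonglongrightarrow> fab p"
    "(\<lambda>n. fba (p + s' n *\<^sub>R b + t' n *\<^sub>R a)) \<longlonglongrightarrow> fba p"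
    using isCont_tendsto_compose[OF cont(1)] isCont_tendsto_compose[OF cont(2)] by auto
  thus ?thesis using st by (simp add: LIMSEQ_unique)
qed

lemma has_derivative_imp_has_dir_deriv:
  assumes "(f has_derivative F) (at p)"
  shows "has_dir_deriv f (F v) v p"
proof -
  have F: "linear F" using assms by (rule has_derivative_linear)
  have "(f has_derivative F) (at (p + 0 *\<^sub>R v))" using assms by simp
  hence "((\<lambda>s. f (p + s *\<^sub>R v)) has_derivative (\<lambda>s. F (s *\<^sub>R v))) (at (0::real))"
    by (rule has_derivative_compose[rotated]) (auto intro!: derivative_eq_intros)
  also have "(\<lambda>s. F (s *\<^sub>R v)) = (*) (F v)"
    by (simp add: linear_scale[OF F] fun_eq_iff)
  finally show ?thesis by (simp add: has_dir_deriv_def has_field_derivative_def)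
qed

lemma differentiable_imp_has_dir_deriv:
  "f differentiable (at p) \<Longrightarrow> has_dir_deriv f (dir_deriv v f p) v p"
  unfolding differentiable_def using has_derivative_imp_has_dir_deriv dir_deriv_eqI by metis

section \<open>Stability of Lipschitz functions on compact sets\<close>

definition lip :: "'a::metric_space set \<Rightarrow> ('a \<Rightarrow> real) \<Rightarrow> bool" where
  "lip Q f \<longleftrightarrow> (\<exists>L. L-lipschitz_on Q f)"

lemma lip_const: "lip Q (\<lambda>x. c)" unfolding lip_def using lipschitz_on_constant by blast

lemma lip_add: "lip Q f \<Longrightarrow> lip Q g \<Longrightarrow> lip Q (\<lambda>x. f x + g x)"
  unfolding lip_def using lipschitz_on_add by blast

lemma lip_diff: "lip Q f \<Longrightarrow> lip Q g \<Longrightarrow> lip Q (\<lambda>x. f x - g x)"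
  unfolding lip_def using lipschitz_on_diff by blast

lemma lip_sum: "(\<And>i. i \<in> I \<Longrightarrow> lip Q (f i)) \<Longrightarrow> lip Q (\<lambda>x. \<Sum>i\<in>I. f i x)"
  by (induction I rule: infinite_finite_induct) (auto intro: lip_const lip_add)

lemma lip_imp_continuous_on: "lip Q f \<Longrightarrow> continuous_on Q f"
  unfolding lip_def using lipschitz_on_continuous_on by blast

lemma lip_bounded:
  assumes "compact Q" "lip Q f"
  obtains B where "0 \<le> B" "\<And>x. x \<in> Q \<Longrightarrow> \<bar>f x\<bar> \<le> B"
proof -
  have "bounded (f ` Q)"
    using assms by (intro compact_imp_bounded compact_continuous_image lip_imp_continuous_on)
  then obtain B where "0 < B" "\<And>x. x \<in> Q \<Longrightarrow> \<bar>f x\<bar> \<le> B" by (auto simp: bounded_pos)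
  thus ?thesis using that[of B] by auto
qed

text \<open>Both factors are bounded on the compact \<open>Q\<close>, which makes the usual
  splitting of the increment uniform.\<close>

lemma lip_mult:
  assumes Q: "compact Q" and "lip Q f" "lip Q g"
  shows "lip Q (\<lambda>x. f x * g x)"
proof -
  obtain A where A: "0 \<le> A" "\<And>x. x \<in> Q \<Longrightarrow> \<bar>f x\<bar> \<le> A" by (rule lip_bounded[OF Q assms(2)]) blast
  obtain B where B: "0 \<le> B" "\<And>x. x \<in> Q \<Longrightarrow> \<bar>g x\<bar> \<le> B" by (rule lip_bounded[OF Q assms(3)]) blast
  obtain L M where L: "L-lipschitz_on Q f" and M: "M-lipschitz_on Q g"
    using assms by (auto simp: lip_def)
  have LM: "0 \<le> L" "0 \<le> M" using L M lipschitz_on_nonneg by blast+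
  have "(A * M + L * B)-lipschitz_on Q (\<lambda>x. f x * g x)"
  proof (rule lipschitz_onI)
    fix x y assume xy: "x \<in> Q" "y \<in> Q"
    have "\<bar>f x * g x - f y * g y\<bar> = \<bar>f x * (g x - g y) + (f x - f y) * g y\<bar>"
      by (simp add: algebra_simps)
    also have "\<dots> \<le> \<bar>f x\<bar> * \<bar>g x - g y\<bar> + \<bar>f x - f y\<bar> * \<bar>g y\<bar>"
      by (metis abs_mult abs_triangle_ineq)
    also have "\<dots> \<le> A * (M * dist x y) + (L * dist x y) * B"
      using xy A B LM lipschitz_onD[OF L xy] lipschitz_onD[OF M xy]
      by (intro add_mono mult_mono) (auto simp: dist_real_def)
    finally show "dist (f x * g x) (f y * g y) \<le> (A * M + L * B) * dist x y"
      by (simp add: dist_real_def algebra_simps)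
  qed (use A B LM in auto)
  thus ?thesis by (auto simp: lip_def)
qed

text \<open>\<open>g'\<close> is bounded on the compact interval that contains the range of
  \<open>f\<close>. This serves for \<open>1 / y\<close>, real powers and \<open>exp\<close>, which
  need not be globally Lipschitz.\<close>

lemma lip_compose_C1:
  fixes g :: "real \<Rightarrow> real"
  assumes f: "lip Q f" "\<And>x. x \<in> Q \<Longrightarrow> f x \<in> {a..b}"
    and g: "\<And>y. y \<in> {a..b} \<Longrightarrow> (g has_real_derivative g' y) (at y)" "continuous_on {a..b} g'"
  shows "lip Q (\<lambda>x. g (f x))"
proof -
  have "bounded (g' ` {a..b})"
    using g(2) by (intro compact_imp_bounded compact_continuous_image) auto
  then obtain B where B: "0 < B" "\<And>y. y \<in> {a..b} \<Longrightarrow> \<bar>g' y\<bar> \<le> B" by (auto simp: bounded_pos)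
  have "B-lipschitz_on {a..b} g"
  proof (rule bounded_derivative_imp_lipschitz)
    show "(g has_derivative (*) (g' y)) (at y within {a..b})" if "y \<in> {a..b}" for y
      using g(1)[OF that] has_derivative_at_withinI unfolding has_field_derivative_def by blast
    show "onorm ((*) (g' y)) \<le> B" if "y \<in> {a..b}" for y
      using B(2)[OF that] by (intro onorm_le) (auto simp: abs_mult mult_right_mono)
  qed (use B in auto)
  moreover obtain L where "L-lipschitz_on Q f" using f by (auto simp: lip_def)
  ultimately have "(B * L)-lipschitz_on Q (\<lambda>x. g (f x))"
    using f(2) by (intro lipschitz_on_compose2) (auto intro: lipschitz_on_subset)
  thus ?thesis by (auto simp: lip_def)
qed

text \<open>The partial derivatives are bounded on \<open>Q\<close>, and expanding a vector in the
  basis bounds the operator norm of the Frechet derivative; convexity then allows the mean value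
  inequality.\<close>

lemma lip_C1:
  fixes f :: "'a::euclidean_space \<Rightarrow> real"
  assumes f: "f differentiable_on UNIV"
    and cont: "\<And>e. e \<in> Basis \<Longrightarrow> continuous_on UNIV (dir_deriv e f)"
    and Q: "compact Q" "convex Q"
  shows "lip Q f"
proof -
  define F where "F p = frechet_derivative f (at p)" for p
  have F: "(f has_derivative F p) (at p)" for p
    using f frechet_derivative_works by (auto simp: differentiable_on_def F_def)
  have Fe: "F p e = dir_deriv e f p" for p e
    using has_derivative_imp_has_dir_deriv[OF F] dir_deriv_eqI by metis
  have "\<exists>B. \<forall>p\<in>Q. \<bar>dir_deriv e f p\<bar> \<le> B" if "e \<in> Basis" for e
  proof -
    have "bounded (dir_deriv e f ` Q)"
      using cont[OF that] Q by (intro compact_imp_bounded compact_continuous_image) (auto intro: continuous_on_subset)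
    thus ?thesis by (auto simp: bounded_iff)
  qed
  then obtain B where B: "\<And>e p. e \<in> Basis \<Longrightarrow> p \<in> Q \<Longrightarrow> \<bar>dir_deriv e f p\<bar> \<le> B e" by metis
  define C where "C = (\<Sum>e\<in>(Basis :: 'a set). \<bar>B e\<bar>)"
  have "C-lipschitz_on Q f"
  proof (rule bounded_derivative_imp_lipschitz)
    show "(f has_derivative F p) (at p within Q)" for p
      using F by (rule has_derivative_at_withinI)
    show "onorm (F p) \<le> C" if "p \<in> Q" for p
    proof (rule onorm_le)
      fix x :: 'a
      have lin: "linear (F p)" using F by (rule has_derivative_linear)
      have "F p x = F p (\<Sum>e\<in>Basis. (x \<bullet> e) *\<^sub>R e)" by (simp add: euclidean_representation)
      also have "\<dots> = (\<Sum>e\<in>Basis. (x \<bullet> e) * F p e)"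
        by (simp add: linear_sum[OF lin] linear_scale[OF lin])
      also have "norm \<dots> \<le> (\<Sum>e\<in>Basis. norm x * \<bar>B e\<bar>)"
      proof (rule sum_norm_le)
        fix e :: 'a assume e: "e \<in> Basis"
        have "\<bar>F p e\<bar> \<le> \<bar>B e\<bar>" using B[OF e \<open>p \<in> Q\<close>] by (simp add: Fe)
        thus "norm ((x \<bullet> e) * F p e) \<le> norm x * \<bar>B e\<bar>"
          using e by (simp add: abs_mult mult_mono Basis_le_norm)
      qed
      also have "\<dots> = C * norm x" by (simp add: C_def sum_distrib_left mult.commute)
      finally show "norm (F p x) \<le> C * norm x" .
    qed
  qed (use Q in \<open>auto simp: C_def intro: sum_nonneg\<close>)
  thus ?thesis by (auto simp: lip_def)
qed

subsection \<open>The commutator identity\<close>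

text \<open>The variables stand for values at one point: \<open>S\<close> for \<open>div W\<close>, \<open>\<xi>\<close> and \<open>h\<close> for
  the gradient and Hessian of \<open>v\<close>, \<open>ht\<close> for \<open>\<nabla>\<partial>\<^sub>t v\<close>, \<open>bk i k\<close> for \<open>\<partial>\<^sub>i \<beta>\<^sub>k\<close>, \<open>ad i\<close> and
  \<open>adt\<close> for \<open>(\<partial>\<^sub>i A) \<xi> \<cdot> \<xi>\<close> and \<open>(\<partial>\<^sub>t A) \<xi> \<cdot> \<xi>\<close>. The subtracted bracket is the
  space-time divergence of the field \<open>(2 W Av + 2 \<beta> H, - H)\<close>.\<close>

lemma carleman_commutator_identity:
  fixes W be \<xi> ht ad qd dAv Hd :: "'n::finite \<Rightarrow> real" and h bk :: "'n \<Rightarrow> 'n \<Rightarrow> real"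
  assumes sym: "\<And>i k. h i k = h k i"
    and Av: "Av = vt - 2 * (\<Sum>k\<in>UNIV. be k * \<xi> k) - f * v"
    and dAv: "\<And>i. dAv i = ht i - 2 * (\<Sum>k\<in>UNIV. bk i k * \<xi> k + be k * h i k) - f * \<xi> i"
    and H: "H = G - q * v\<^sup>2"
    and G: "G = (\<Sum>i\<in>UNIV. W i * \<xi> i)"
    and Hd: "\<And>i. Hd i = ad i + 2 * (\<Sum>j\<in>UNIV. W j * h i j) - qd i * v\<^sup>2 - 2 * q * v * \<xi> i"
    and Ht: "Ht = adt + 2 * (\<Sum>j\<in>UNIV. W j * ht j) - qt * v\<^sup>2 - 2 * q * v * vt"
    and d: "d = (\<Sum>i\<in>UNIV. bk i i)"
  shows "2 * (S + q * v) * Av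
      - (2 * S * Av + 2 * (\<Sum>i\<in>UNIV. W i * dAv i) + 2 * d * H + 2 * (\<Sum>i\<in>UNIV. be i * Hd i) - Ht)
    = (2 * f - 2 * d) * G + 4 * (\<Sum>i\<in>UNIV. \<Sum>k\<in>UNIV. bk i k * W i * \<xi> k)
      + (adt - 2 * (\<Sum>i\<in>UNIV. be i * ad i))
      + (2 * d * q - 2 * f * q - (qt - 2 * (\<Sum>i\<in>UNIV. be i * qd i))) * v\<^sup>2"
proof -
  \<comment> \<open>\<open>Y\<close> collects the Hessian terms. They enter through
    \<open>dAv\<close> and \<open>Hd\<close> with opposite signs and cancel by the symmetry of
    \<open>h\<close>.\<close>
  define Y where "Y = (\<Sum>i\<in>UNIV. \<Sum>k\<in>UNIV. W i * (be k * h i k))"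
  have 1: "(\<Sum>i\<in>UNIV. W i * dAv i) = (\<Sum>i\<in>UNIV. W i * ht i)
      - 2 * (\<Sum>i\<in>UNIV. \<Sum>k\<in>UNIV. bk i k * W i * \<xi> k) - 2 * Y - f * G"
    unfolding dAv G Y_def
    by (simp add: algebra_simps sum.distrib sum_subtractf sum_distrib_left)
  have 2: "(\<Sum>i\<in>UNIV. be i * Hd i) = (\<Sum>i\<in>UNIV. be i * ad i) + 2 * Y
      - (\<Sum>i\<in>UNIV. be i * qd i) * v\<^sup>2 - 2 * q * v * (\<Sum>k\<in>UNIV. be k * \<xi> k)"
  proof -
    have "(\<Sum>i\<in>UNIV. \<Sum>j\<in>UNIV. be i * (W j * h i j)) = Y"
      unfolding Y_def by (subst sum.swap) (simp add: sym mult_ac)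
    moreover have "be i * Hd i = be i * ad i + 2 * (\<Sum>j\<in>UNIV. be i * (W j * h i j))
        - be i * qd i * v\<^sup>2 - 2 * q * v * (be i * \<xi> i)" for i
      unfolding Hd by (simp add: algebra_simps sum_distrib_left)
    ultimately show ?thesis
      by (simp add: sum.distrib sum_subtractf flip: sum_distrib_left sum_distrib_right)
  qed
  \<comment> \<open>The terms with \<open>ht\<close> cancel as well, and so do the products of
    \<open>q * v\<close> with \<open>vt\<close> and with the drift; what survives of
    \<open>q\<close> is quadratic in \<open>v\<close>.\<close>
  show ?thesis unfolding 1 2 Ht H Av by (simp add: algebra_simps power2_eq_square)
qed

section \<open>Bounds for finite sums and for the zeroth-order coefficient\<close>

lemma bilinear_sum_bound:
  fixes m :: "'n::finite \<Rightarrow> 'n \<Rightarrow> real"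
  assumes m: "\<And>i j. \<bar>m i j\<bar> \<le> B" and y: "\<And>i. \<bar>y i\<bar> \<le> Y" and z: "\<And>i. \<bar>z i\<bar> \<le> Z"
  shows "\<bar>\<Sum>i\<in>UNIV. \<Sum>j\<in>UNIV. m i j * y i * z j\<bar> \<le> (real CARD('n))\<^sup>2 * (B * Y * Z)"
proof -
  have B: "0 \<le> B" "0 \<le> Y" "0 \<le> Z" using m y z abs_ge_zero order_trans by blast+
  have "\<bar>\<Sum>i\<in>UNIV. \<Sum>j\<in>UNIV. m i j * y i * z j\<bar> \<le> (\<Sum>i\<in>(UNIV::'n set). \<Sum>j\<in>(UNIV::'n set). B * Y * Z)"
    unfolding real_norm_def[symmetric]
  proof (intro sum_norm_le)
    fix i j
    show "norm (m i j * y i * z j) \<le> B * Y * Z"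
      unfolding real_norm_def abs_mult using B m y z by (intro mult_mono) auto
  qed
  also have "\<dots> = (real CARD('n))\<^sup>2 * (B * Y * Z)" by (simp add: power2_eq_square)
  finally show ?thesis .
qed

lemma linear_sum_bound:
  fixes m :: "'n::finite \<Rightarrow> real"
  assumes m: "\<And>i. \<bar>m i\<bar> \<le> B" and y: "\<And>i. \<bar>y i\<bar> \<le> Y"
  shows "\<bar>\<Sum>i\<in>UNIV. m i * y i\<bar> \<le> real CARD('n) * (B * Y)"
proof -
  have B: "0 \<le> B" "0 \<le> Y" using m y abs_ge_zero order_trans by blast+
  have "\<bar>\<Sum>i\<in>UNIV. m i * y i\<bar> \<le> (\<Sum>i\<in>(UNIV::'n set). B * Y)"
    unfolding real_norm_def[symmetric]
  proof (intro sum_norm_le)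
    fix i show "norm (m i * y i) \<le> B * Y"
      unfolding real_norm_def abs_mult using B m y by (intro mult_mono) auto
  qed
  thus ?thesis by simp
qed

text \<open>The terms are compared on the scales \<open>g / t\<close>, \<open>K / t ^ 3\<close> and
  \<open>r / t\<close>. Large \<open>k1\<close> makes the last two coefficients positive, large
  \<open>K\<close> the first; one copy of \<open>K / t ^ 3\<close> is set aside to absorb the
  squared error. The letters have the meaning they get in \<open>carleman_bounds\<close>.\<close>

lemma zeroth_order_coefficient_bound:
  fixes t g r s K k1 D :: real
  assumes t: "0 < t" "t < 2" and g: "0 \<le> g" and r: "0 \<le> r" and s: "0 \<le> s" "s \<le> r / 8"
    and q: "q = g - K / (2 * t\<^sup>2) - r / 2 + s"
    and qt: "qt \<le> - (K + 1) * g / t + K / t ^ 3 + r / t + c1 * r / t"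
    and bq: "\<bar>bq\<bar> \<le> C4 * r / t" and d: "\<bar>d\<bar> \<le> D / t"
    and k1: "D + 2 \<le> k1" "4 * b \<le> 3 * k1 / 4 - 1 - c1 - C4 - D" "0 \<le> b"
    and K: "8 + 2 * (k1 + D)\<^sup>2 \<le> K" "2 * k1 + 2 * D \<le> K + 1"
  shows "1 + 2 * b * r \<le> 2 * d * q - 2 * (k1 / t) * q - (qt - bq) - (k1 / t - d)\<^sup>2"
proof -
  define i where "i = 1 / t"
  have i: "1 / 2 \<le> i" "0 < i" using t by (auto simp: i_def field_simps)
  have D: "0 \<le> D" using d t abs_ge_zero[of d] by (smt (verit) divide_neg_pos)
  have k10: "0 \<le> k1" using D k1 by linarith
  have K0: "0 \<le> K" using K(1) zero_le_power2[of "k1 + D"] by linarith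
  have q': "q = g - K * i\<^sup>2 / 2 - r / 2 + s" using q by (simp add: i_def power_divide)
  have qt': "qt \<le> - (K + 1) * g * i + K * i ^ 3 + r * i + c1 * r * i"
    using qt by (simp add: i_def power_divide)
  have bq': "\<bar>bq\<bar> \<le> C4 * r * i" using bq by (simp add: i_def)
  have d': "\<bar>d\<bar> \<le> D * i" using d by (simp add: i_def)
  have "\<bar>q\<bar> \<le> g + K * i\<^sup>2 / 2 + r / 2"
    using q' g r s K0 zero_le_power2[of i] mult_nonneg_nonneg[of K "i\<^sup>2"] by linarith
  hence "\<bar>d * q\<bar> \<le> D * i * (g + K * i\<^sup>2 / 2 + r / 2)"
    unfolding abs_mult using d' D i by (intro mult_mono) auto
  hence 1: "2 * d * q \<ge> - (2 * D * i * g + D * (K * i ^ 3) + D * i * r)"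
    by (simp add: abs_le_iff algebra_simps power2_eq_square power3_eq_cube)
  have 2: "- 2 * k1 * i * q \<ge> - 2 * k1 * i * g + k1 * (K * i ^ 3) + 3 * k1 / 4 * (i * r)"
  proof -
    \<comment> \<open>\<open>s\<close> is at most a quarter of \<open>r / 2\<close>, so
      \<open>- r / 2 + s\<close> stays at or below \<open>- 3 * r / 8\<close>; this is the source of
      the good term in \<open>r\<close>.\<close>
    have "q \<le> g - K * i\<^sup>2 / 2 - 3 * r / 8" using q' s by linarith
    hence "2 * k1 * i * q \<le> 2 * k1 * i * (g - K * i\<^sup>2 / 2 - 3 * r / 8)"
      using k10 i by (intro mult_left_mono) auto
    thus ?thesis by (simp add: algebra_simps power2_eq_square power3_eq_cube)
  qed
  have 3: "(k1 * i - d)\<^sup>2 \<le> (k1 + D)\<^sup>2 * i\<^sup>2"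
  proof -
    have "\<bar>k1 * i - d\<bar> \<le> (k1 + D) * i" 
      using d' mult_nonneg_nonneg[OF k10, of i] i(2) unfolding distrib_right by linarith
    hence "(k1 * i - d)\<^sup>2 \<le> ((k1 + D) * i)\<^sup>2" by (rule power2_le_iff_abs_le[THEN iffD2, rotated]) (use D k10 i in auto)
    thus ?thesis by (simp add: power_mult_distrib)
  qed
  have 4: "1 \<le> K * i ^ 3 - (k1 + D)\<^sup>2 * i\<^sup>2"
  proof -
    \<comment> \<open>\<open>K / 2\<close> is at least \<open>4 + (k1 + D)\<^sup>2\<close> and
      \<open>i\<^sup>2\<close> at least \<open>1 / 4\<close>, so the 8 in the bound for
      \<open>K\<close> leaves exactly 1.\<close>
    have "K * (1 / 2) \<le> K * i" using K0 i by (intro mult_left_mono) auto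
    hence "4 \<le> K * i - (k1 + D)\<^sup>2" using K(1) by linarith
    moreover have "(1 / 2)\<^sup>2 \<le> i\<^sup>2" using i by (intro power_mono) auto
    ultimately have "(1 / 2)\<^sup>2 * 4 \<le> i\<^sup>2 * (K * i - (k1 + D)\<^sup>2)" by (intro mult_mono) auto
    thus ?thesis by (simp add: algebra_simps power2_eq_square power3_eq_cube)
  qed
  have 5: "0 \<le> (K + 1 - 2 * k1 - 2 * D) * (g * i)" using K(2) g i by (intro mult_nonneg_nonneg) auto
  have 6: "0 \<le> (k1 - 2 - D) * (K * i ^ 3)" using k1 K0 i by (intro mult_nonneg_nonneg) auto
  \<comment> \<open>\<open>2 * b * r\<close> is reserved for passing from \<open>\<nabla>v\<close>
    back to \<open>\<nabla>u\<close>; \<open>t < 2\<close> converts it to the scale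
    \<open>r / t\<close>.\<close>
  have 7: "2 * b * r \<le> 4 * b * (r * i)"
  proof -
    have "b * r * (1 / 2) \<le> b * r * i" using i r k1 by (intro mult_left_mono mult_nonneg_nonneg) auto
    thus ?thesis by (simp add: mult_ac)
  qed
  have 8: "4 * b * (r * i) \<le> (3 * k1 / 4 - 1 - c1 - C4 - D) * (r * i)"
    using k1 r i by (intro mult_right_mono) auto
  have "2 * d * q - 2 * (k1 / t) * q - (qt - bq) - (k1 / t - d)\<^sup>2
      = 2 * d * q + (- 2 * k1 * i * q) - qt + bq - (k1 * i - d)\<^sup>2"
    by (simp add: i_def)
  also have "\<dots> \<ge> - (2 * D * i * g + D * (K * i ^ 3) + D * i * r)
      + (- 2 * k1 * i * g + k1 * (K * i ^ 3) + 3 * k1 / 4 * (i * r))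
      - (- (K + 1) * g * i + K * i ^ 3 + r * i + c1 * r * i) - C4 * r * i - (k1 + D)\<^sup>2 * i\<^sup>2"
    using 1 2 3 qt' bq' by linarith
  moreover have "- (2 * D * i * g + D * (K * i ^ 3) + D * i * r)
      + (- 2 * k1 * i * g + k1 * (K * i ^ 3) + 3 * k1 / 4 * (i * r))
      - (- (K + 1) * g * i + K * i ^ 3 + r * i + c1 * r * i) - C4 * r * i - (k1 + D)\<^sup>2 * i\<^sup>2
    = (K + 1 - 2 * k1 - 2 * D) * (g * i) + (k1 - 2 - D) * (K * i ^ 3)
      + (3 * k1 / 4 - 1 - c1 - C4 - D) * (r * i) + (K * i ^ 3 - (k1 + D)\<^sup>2 * i\<^sup>2)"
    by (simp add: algebra_simps)
  ultimately show ?thesis using 4 5 6 7 8 by linarith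
qed

subsection \<open>The conjugated fields\<close>

lemma has_dir_deriv_cong: "has_dir_deriv f D v p \<Longrightarrow> D = D' \<Longrightarrow> has_dir_deriv f D' v p" by simp

lemma has_dir_deriv_const: "has_dir_deriv (\<lambda>p. c) 0 v p"
  unfolding has_dir_deriv_def by (rule DERIV_const)

lemma has_dir_deriv_add: "has_dir_deriv f D v p \<Longrightarrow> has_dir_deriv g D' v p \<Longrightarrow>
    has_dir_deriv (\<lambda>p. f p + g p) (D + D') v p"
  unfolding has_dir_deriv_def by (rule DERIV_add)

lemma has_dir_deriv_diff: "has_dir_deriv f D v p \<Longrightarrow> has_dir_deriv g D' v p \<Longrightarrow>
    has_dir_deriv (\<lambda>p. f p - g p) (D - D') v p"
  unfolding has_dir_deriv_def by (rule DERIV_diff)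

lemma has_dir_deriv_mult: "has_dir_deriv f D v p \<Longrightarrow> has_dir_deriv g D' v p \<Longrightarrow>
    has_dir_deriv (\<lambda>p. f p * g p) (D * g p + f p * D') v p"
  unfolding has_dir_deriv_def using DERIV_mult by (fastforce simp: mult.commute add.commute)

lemma has_dir_deriv_cmult: "has_dir_deriv f D v p \<Longrightarrow> has_dir_deriv (\<lambda>p. c * f p) (c * D) v p"
  unfolding has_dir_deriv_def by (rule DERIV_cmult)

lemma has_dir_deriv_sum: "(\<And>i. i \<in> I \<Longrightarrow> has_dir_deriv (f i) (D i) v p) \<Longrightarrow>
    has_dir_deriv (\<lambda>p. \<Sum>i\<in>I. f i p) (\<Sum>i\<in>I. D i) v p"
  unfolding has_dir_deriv_def by (rule DERIV_sum)

lemma has_dir_deriv_chain: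
  assumes "(g has_real_derivative g') (at (f p))" "has_dir_deriv f D v p"
  shows "has_dir_deriv (\<lambda>p. g (f p)) (g' * D) v p"
proof -
  have "(g has_real_derivative g') (at (f (p + 0 *\<^sub>R v)))" using assms(1) by simp
  thus ?thesis using assms(2) unfolding has_dir_deriv_def by (rule DERIV_chain2)
qed

lemma has_dir_deriv_fst_nth: "has_dir_deriv (\<lambda>p. fst p $ i) (fst v $ i) v p"
  unfolding has_dir_deriv_def by (auto intro!: derivative_eq_intros)

lemma has_dir_deriv_snd: "has_dir_deriv snd (snd v) v p"
  unfolding has_dir_deriv_def by (auto intro!: derivative_eq_intros)

lemma has_dir_deriv_norm_fst_sq:
  "has_dir_deriv (\<lambda>p::'a::real_inner \<times> real. (norm (fst p))\<^sup>2) (2 * (fst p \<bullet> fst v)) v p"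
proof -
  have "(\<lambda>s. (norm (fst (p + s *\<^sub>R v)))\<^sup>2)
      = (\<lambda>s. (norm (fst p))\<^sup>2 + 2 * (fst p \<bullet> fst v) * s + (norm (fst v))\<^sup>2 * (s * s))"
    by (simp add: fun_eq_iff power2_norm_eq_inner inner_add inner_commute algebra_simps)
  thus ?thesis unfolding has_dir_deriv_def by (auto intro!: derivative_eq_intros)
qed

lemma has_dir_deriv_inverse_snd: "0 < snd p \<Longrightarrow> has_dir_deriv (\<lambda>p. 1 / snd p) (- (snd v / (snd p)\<^sup>2)) v p"
proof (rule has_dir_deriv_cong[OF has_dir_deriv_chain[of "\<lambda>y. 1 / y" "- (1 / (snd p)\<^sup>2)"]])
  show "0 < snd p \<Longrightarrow> ((/) 1 has_real_derivative - (1 / (snd p)\<^sup>2)) (at (snd p))"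
    by (auto intro!: derivative_eq_intros simp: power2_eq_square)
qed (auto intro: has_dir_deriv_snd)

section \<open>The weight, the conjugated function and the fields\<close>

locale carleman_fields =
  fixes A :: "(real^'n::finite) \<times> real \<Rightarrow> real^'n^'n" and u :: "(real^'n) \<times> real \<Rightarrow> real"
    and b K \<gamma> k1 :: real
begin

definition phi :: "(real^'n) \<times> real \<Rightarrow> real" where
  "phi p = \<gamma> * (snd p powr (- K) - 1) - (b * (norm (fst p))\<^sup>2 + K) * (1 / snd p) / 2"

text \<open>\<open>phix i\<close> and \<open>phit\<close> are the first derivatives of
  \<open>phi\<close> for positive time. As explicit expressions they can be differentiated again;
  the factor \<open>1 / snd p\<close> is kept separate for the product rules.\<close>

definition phix :: "'n \<Rightarrow> (real^'n) \<times> real \<Rightarrow> real" where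
  "phix i p = - b * (fst p $ i * (1 / snd p))"

definition phit :: "(real^'n) \<times> real \<Rightarrow> real" where
  "phit p = - (\<gamma> * K) * snd p powr (- K - 1) + (b * (norm (fst p))\<^sup>2 + K) * (1 / snd p) * (1 / snd p) / 2"

definition om :: "(real^'n) \<times> real \<Rightarrow> real" where "om p = exp (phi p)"

definition v :: "(real^'n) \<times> real \<Rightarrow> real" where "v p = om p * u p"

text \<open>\<open>vx\<close> and \<open>vt\<close> are the derivatives of \<open>v\<close> with the
  product rule written out, so that their regularity follows from that of \<open>u\<close> and its
  first derivatives.\<close>

definition vx :: "'n \<Rightarrow> (real^'n) \<times> real \<Rightarrow> real" where
  "vx i p = om p * (d_x i u p + phix i p * u p)"

definition vt :: "(real^'n) \<times> real \<Rightarrow> real" where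
  "vt p = om p * (d_t u p + phit p * u p)"

definition beta :: "'n \<Rightarrow> (real^'n) \<times> real \<Rightarrow> real" where
  "beta i p = (\<Sum>j\<in>UNIV. A p $ i $ j * phix j p)"

definition q :: "(real^'n) \<times> real \<Rightarrow> real" where
  "q p = (\<Sum>i\<in>UNIV. phix i p * beta i p) - phit p"

definition W :: "'n \<Rightarrow> (real^'n) \<times> real \<Rightarrow> real" where
  "W i p = (\<Sum>j\<in>UNIV. A p $ i $ j * vx j p)"

text \<open>The second bracket of the splitting, with \<open>f = k1 / t\<close>.\<close>

definition Av :: "(real^'n) \<times> real \<Rightarrow> real" where
  "Av p = vt p - 2 * (\<Sum>k\<in>UNIV. beta k p * vx k p) - k1 * (1 / snd p) * v p"

text \<open>The energy density belonging to the first bracket; its negative is the time component of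
  the divergence field.\<close>

definition H :: "(real^'n) \<times> real \<Rightarrow> real" where
  "H p = (\<Sum>i\<in>UNIV. W i p * vx i p) - q p * (v p * v p)"

text \<open>The spatial components of that field.\<close>

definition X :: "'n \<Rightarrow> (real^'n) \<times> real \<Rightarrow> real" where
  "X i p = 2 * (W i p * Av p + beta i p * H p)"

lemma has_dir_deriv_phi:
  assumes "0 < snd p"
  shows "has_dir_deriv phi ((\<Sum>i\<in>UNIV. phix i p * fst w $ i) + phit p * snd w) w p"
  unfolding phi_def[abs_def]
proof (rule has_dir_deriv_cong)
  show "has_dir_deriv (\<lambda>p. \<gamma> * (snd p powr (- K) - 1) - (b * (norm (fst p))\<^sup>2 + K) * (1 / snd p) / 2)
    (\<gamma> * (- K * snd p powr (- K - 1) * snd w - 0)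
      - ((b * (2 * (fst p \<bullet> fst w)) + 0) * (1 / snd p) + (b * (norm (fst p))\<^sup>2 + K) * - (snd w / (snd p)\<^sup>2)) / 2) w p"
    \<comment> \<open>Division by 2 becomes a constant factor on the left, the form that
      \<open>has_dir_deriv_cmult\<close> expects.\<close>
    unfolding divide_inverse[of _ 2] mult.commute[of _ "inverse 2"]
    by (intro has_dir_deriv_diff has_dir_deriv_add has_dir_deriv_cmult has_dir_deriv_mult has_dir_deriv_const has_dir_deriv_norm_fst_sq has_dir_deriv_inverse_snd assms
         has_dir_deriv_chain[where f = snd] has_real_derivative_powr has_dir_deriv_snd)
  have "(\<Sum>i\<in>UNIV. phix i p * fst w $ i) = - b * (fst p \<bullet> fst w) / snd p"
    unfolding phix_def inner_vec_def
    by (simp add: sum_distrib_left sum_divide_distrib mult.assoc)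
  thus "\<gamma> * (- K * snd p powr (- K - 1) * snd w - 0)
      - ((b * (2 * (fst p \<bullet> fst w)) + 0) * (1 / snd p) + (b * (norm (fst p))\<^sup>2 + K) * - (snd w / (snd p)\<^sup>2)) / 2
    = (\<Sum>i\<in>UNIV. phix i p * fst w $ i) + phit p * snd w"
    by (simp add: phit_def power2_eq_square diff_divide_distrib add_divide_distrib algebra_simps)
qed

lemma has_dir_deriv_phix:
  assumes "0 < snd p"
  shows "has_dir_deriv (phix i) (- b * fst w $ i / snd p + b * fst p $ i * snd w / (snd p)\<^sup>2) w p"
  unfolding phix_def[abs_def]
proof (rule has_dir_deriv_cong)
  show "has_dir_deriv (\<lambda>p. - b * (fst p $ i * (1 / snd p)))
    (- b * (fst w $ i * (1 / snd p) + fst p $ i * - (snd w / (snd p)\<^sup>2))) w p"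
    by (intro has_dir_deriv_cmult has_dir_deriv_mult has_dir_deriv_fst_nth has_dir_deriv_inverse_snd assms)
qed (simp add: algebra_simps)

lemma has_dir_deriv_phit:
  assumes "0 < snd p"
  shows "has_dir_deriv phit (\<gamma> * K * (K + 1) * snd p powr (- K - 2) * snd w
      + b * (fst p \<bullet> fst w) / (snd p)\<^sup>2 - (b * (norm (fst p))\<^sup>2 + K) * snd w / (snd p) ^ 3) w p"
  unfolding phit_def[abs_def]
proof (rule has_dir_deriv_cong)
  show "has_dir_deriv (\<lambda>p. - (\<gamma> * K) * snd p powr (- K - 1) + (b * (norm (fst p))\<^sup>2 + K) * (1 / snd p) * (1 / snd p) / 2)
    (- (\<gamma> * K) * ((- K - 1) * snd p powr (- K - 1 - 1) * snd w)
      + inverse 2 * (((b * (2 * (fst p \<bullet> fst w)) + 0) * (1 / snd p) + (b * (norm (fst p))\<^sup>2 + K) * - (snd w / (snd p)\<^sup>2))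
          * (1 / snd p) + (b * (norm (fst p))\<^sup>2 + K) * (1 / snd p) * - (snd w / (snd p)\<^sup>2))) w p"
    unfolding divide_inverse[of _ 2] mult.commute[of _ "inverse 2"]
    by (intro has_dir_deriv_diff has_dir_deriv_add has_dir_deriv_cmult has_dir_deriv_mult has_dir_deriv_const has_dir_deriv_norm_fst_sq has_dir_deriv_inverse_snd assms
         has_dir_deriv_chain[where f = snd] has_real_derivative_powr has_dir_deriv_snd)
qed (use assms in \<open>simp add: field_simps power2_eq_square power3_eq_cube\<close>)

lemma has_dir_deriv_om:
  assumes "0 < snd p"
  shows "has_dir_deriv om (om p * ((\<Sum>i\<in>UNIV. phix i p * fst w $ i) + phit p * snd w)) w p"
  unfolding om_def[abs_def] by (intro has_dir_deriv_chain DERIV_exp has_dir_deriv_phi assms)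

end

text \<open>\<open>A\<close> is differentiable only almost everywhere, so derivatives are taken at
  one fixed point and their values are parameters. The shared \<open>uxt\<close> encodes that the
  mixed derivatives of \<open>u\<close> in space and time agree.\<close>

locale carleman_point = carleman_fields A u b K \<gamma> k1
  for A :: "(real^'n::finite) \<times> real \<Rightarrow> real^'n^'n" and u b K \<gamma> k1 +
  fixes p :: "(real^'n) \<times> real" and ak :: "'n \<Rightarrow> 'n \<Rightarrow> 'n \<Rightarrow> real" and adt :: "'n \<Rightarrow> 'n \<Rightarrow> real"
    and uxx :: "'n \<Rightarrow> 'n \<Rightarrow> real" and uxt :: "'n \<Rightarrow> real"
  assumes t0: "0 < snd p"
    and A_sym: "\<And>i j. A p $ i $ j = A p $ j $ i"
    and has_dir_deriv_A: "\<And>k i j. has_dir_deriv (\<lambda>p. A p $ i $ j) (ak k i j) (axis k 1, 0) p"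
    and has_dir_deriv_A_t: "\<And>i j. has_dir_deriv (\<lambda>p. A p $ i $ j) (adt i j) (0, 1) p"
    and has_dir_deriv_u: "\<And>i. has_dir_deriv u (d_x i u p) (axis i 1, 0) p"
    and has_dir_deriv_u_t: "has_dir_deriv u (d_t u p) (0, 1) p"
    and has_dir_deriv_ux: "\<And>i k. has_dir_deriv (d_x i u) (uxx k i) (axis k 1, 0) p"
    and has_dir_deriv_ux_t: "\<And>i. has_dir_deriv (d_x i u) (uxt i) (0, 1) p"
    and has_dir_deriv_ut: "\<And>i. has_dir_deriv (d_t u) (uxt i) (axis i 1, 0) p"
    and uxx_sym: "\<And>i k. uxx i k = uxx k i"
begin

section \<open>Derivatives of the fields at the point\<close>

abbreviation "t \<equiv> snd p"
abbreviation "x \<equiv> fst p"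

text \<open>The spatial Hessian of \<open>phi\<close>, a multiple of the identity. In doubly indexed
  values here and below the first index is the direction of differentiation, and the values keep the
  raw shape that the product rules produce; \<open>b * x $ i / t\<^sup>2\<close> is the mixed
  derivative of \<open>phi\<close> in either order.\<close>

definition dphix :: "'n \<Rightarrow> 'n \<Rightarrow> real" where "dphix k i = (if i = k then - b / t else 0)"
definition "h k i = om p * phix k p * (d_x i u p + phix i p * u p)
    + om p * (uxx k i + (dphix k i * u p + phix i p * d_x k u p))"
definition "ht i = om p * phit p * (d_x i u p + phix i p * u p)
    + om p * (uxt i + (b * x $ i / t\<^sup>2 * u p + phix i p * d_t u p))"
definition "bk k i = (\<Sum>j\<in>UNIV. ak k i j * phix j p + A p $ i $ j * dphix k j)"
definition "bt i = (\<Sum>j\<in>UNIV. adt i j * phix j p + A p $ i $ j * (b * x $ j / t\<^sup>2))"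
definition "qd k = (\<Sum>i\<in>UNIV. dphix k i * beta i p + phix i p * bk k i) - b * x $ k / t\<^sup>2"
definition "qt = (\<Sum>i\<in>UNIV. b * x $ i / t\<^sup>2 * beta i p + phix i p * bt i)
    - (\<gamma> * K * (K + 1) * t powr (- K - 2) - (b * (norm x)\<^sup>2 + K) / t ^ 3)"
definition "dW k i = (\<Sum>j\<in>UNIV. ak k i j * vx j p + A p $ i $ j * h k j)"
definition "Wt i = (\<Sum>j\<in>UNIV. adt i j * vx j p + A p $ i $ j * ht j)"
definition "dAv i = ht i - 2 * (\<Sum>k\<in>UNIV. bk i k * vx k p + beta k p * h i k) - k1 / t * vx i p"
definition "Hd k = (\<Sum>i\<in>UNIV. dW k i * vx i p + W i p * h k i)
    - (qd k * (v p * v p) + q p * (vx k p * v p + v p * vx k p))"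
definition "Ht = (\<Sum>i\<in>UNIV. Wt i * vx i p + W i p * ht i)
    - (qt * (v p * v p) + q p * (vt p * v p + v p * vt p))"

lemma has_dir_deriv_om_x: "has_dir_deriv om (om p * phix k p) (axis k 1, 0) p"
  by (rule has_dir_deriv_cong[OF has_dir_deriv_om[OF t0]]) (simp add: axis_def if_distrib cong: if_cong)

lemma has_dir_deriv_om_t: "has_dir_deriv om (om p * phit p) (0, 1) p"
  by (rule has_dir_deriv_cong[OF has_dir_deriv_om[OF t0]]) simp

lemma has_dir_deriv_phix_x: "has_dir_deriv (phix i) (dphix k i) (axis k 1, 0) p"
  by (rule has_dir_deriv_cong[OF has_dir_deriv_phix[OF t0]]) (simp add: dphix_def axis_def)

lemma has_dir_deriv_phix_t: "has_dir_deriv (phix i) (b * x $ i / t\<^sup>2) (0, 1) p"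
  by (rule has_dir_deriv_cong[OF has_dir_deriv_phix[OF t0]]) simp

lemma has_dir_deriv_phit_x: "has_dir_deriv phit (b * x $ k / t\<^sup>2) (axis k 1, 0) p"
  by (rule has_dir_deriv_cong[OF has_dir_deriv_phit[OF t0]]) (simp add: inner_axis)

lemma has_dir_deriv_phit_t: "has_dir_deriv phit (\<gamma> * K * (K + 1) * t powr (- K - 2) - (b * (norm x)\<^sup>2 + K) / t ^ 3) (0, 1) p"
  by (rule has_dir_deriv_cong[OF has_dir_deriv_phit[OF t0]]) simp

lemma has_dir_deriv_v: "has_dir_deriv v (vx k p) (axis k 1, 0) p"
  unfolding v_def[abs_def]
  by (rule has_dir_deriv_cong[OF has_dir_deriv_mult[OF has_dir_deriv_om_x has_dir_deriv_u]]) (simp add: vx_def algebra_simps)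

lemma has_dir_deriv_v_t: "has_dir_deriv v (vt p) (0, 1) p"
  unfolding v_def[abs_def]
  by (rule has_dir_deriv_cong[OF has_dir_deriv_mult[OF has_dir_deriv_om_t has_dir_deriv_u_t]]) (simp add: vt_def algebra_simps)

lemma has_dir_deriv_vx: "has_dir_deriv (vx i) (h k i) (axis k 1, 0) p"
  unfolding vx_def[abs_def] h_def
  by (intro has_dir_deriv_mult has_dir_deriv_add has_dir_deriv_om_x has_dir_deriv_ux has_dir_deriv_phix_x has_dir_deriv_u)

lemma has_dir_deriv_vx_t: "has_dir_deriv (vx i) (ht i) (0, 1) p"
  unfolding vx_def[abs_def] ht_def
  by (intro has_dir_deriv_mult has_dir_deriv_add has_dir_deriv_om_t has_dir_deriv_ux_t has_dir_deriv_phix_t has_dir_deriv_u_t)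

text \<open>The value agrees with the time derivative of \<open>vx k\<close>, because
  \<open>uxt\<close> and the mixed derivative of \<open>phi\<close> occur in both. The cancellation
  of \<open>ht\<close> in the commutator identity rests on this.\<close>

lemma has_dir_deriv_vt_x: "has_dir_deriv vt (ht k) (axis k 1, 0) p"
  unfolding vt_def[abs_def]
  by (rule has_dir_deriv_cong[OF has_dir_deriv_mult[OF has_dir_deriv_om_x has_dir_deriv_add[OF has_dir_deriv_ut has_dir_deriv_mult[OF has_dir_deriv_phit_x has_dir_deriv_u]]]])
    (simp add: ht_def algebra_simps)

lemma has_dir_deriv_beta: "has_dir_deriv (beta i) (bk k i) (axis k 1, 0) p"
  unfolding beta_def[abs_def] bk_def by (intro has_dir_deriv_sum has_dir_deriv_mult has_dir_deriv_A has_dir_deriv_phix_x)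

lemma has_dir_deriv_beta_t: "has_dir_deriv (beta i) (bt i) (0, 1) p"
  unfolding beta_def[abs_def] bt_def by (intro has_dir_deriv_sum has_dir_deriv_mult has_dir_deriv_A_t has_dir_deriv_phix_t)

lemma has_dir_deriv_q: "has_dir_deriv q (qd k) (axis k 1, 0) p"
  unfolding q_def[abs_def] qd_def by (intro has_dir_deriv_sum has_dir_deriv_diff has_dir_deriv_mult has_dir_deriv_beta has_dir_deriv_phix_x has_dir_deriv_phit_x)

lemma has_dir_deriv_q_t: "has_dir_deriv q qt (0, 1) p"
  unfolding q_def[abs_def] qt_def by (intro has_dir_deriv_sum has_dir_deriv_diff has_dir_deriv_mult has_dir_deriv_beta_t has_dir_deriv_phix_t has_dir_deriv_phit_t)

lemma has_dir_deriv_W: "has_dir_deriv (W i) (dW k i) (axis k 1, 0) p"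
  unfolding W_def[abs_def] dW_def by (intro has_dir_deriv_sum has_dir_deriv_mult has_dir_deriv_A has_dir_deriv_vx)

lemma has_dir_deriv_W_t: "has_dir_deriv (W i) (Wt i) (0, 1) p"
  unfolding W_def[abs_def] Wt_def by (intro has_dir_deriv_sum has_dir_deriv_mult has_dir_deriv_A_t has_dir_deriv_vx_t)

lemma has_dir_deriv_Av: "has_dir_deriv Av (dAv k) (axis k 1, 0) p"
  unfolding Av_def[abs_def]
proof (rule has_dir_deriv_cong)
  \<comment> \<open>\<open>snd (axis k 1, 0)\<close> is 0: the coefficient \<open>k1 / t\<close> is
    constant in space and contributes no derivative of its own.\<close>
  show "has_dir_deriv (\<lambda>p. vt p - 2 * (\<Sum>k\<in>UNIV. beta k p * vx k p) - k1 * (1 / snd p) * v p)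
      (ht k - 2 * (\<Sum>j\<in>UNIV. bk k j * vx j p + beta j p * h k j)
        - (k1 * - (snd (axis k 1 :: real^'n, 0 :: real) / (snd p)\<^sup>2) * v p + k1 * (1 / snd p) * vx k p)) (axis k 1, 0) p"
    by (intro has_dir_deriv_sum has_dir_deriv_mult has_dir_deriv_cmult has_dir_deriv_diff has_dir_deriv_vt_x has_dir_deriv_beta has_dir_deriv_vx has_dir_deriv_v has_dir_deriv_inverse_snd t0)
qed (simp add: dAv_def)

lemma has_dir_deriv_H: "has_dir_deriv H (Hd k) (axis k 1, 0) p"
  unfolding H_def[abs_def] Hd_def by (intro has_dir_deriv_sum has_dir_deriv_diff has_dir_deriv_mult has_dir_deriv_W has_dir_deriv_vx has_dir_deriv_q has_dir_deriv_v)

lemma has_dir_deriv_H_t: "has_dir_deriv H Ht (0, 1) p"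
  unfolding H_def[abs_def] Ht_def by (intro has_dir_deriv_sum has_dir_deriv_diff has_dir_deriv_mult has_dir_deriv_W_t has_dir_deriv_vx_t has_dir_deriv_q_t has_dir_deriv_v_t)

lemma has_dir_deriv_X: "has_dir_deriv (X i) (2 * ((dW k i * Av p + W i p * dAv k) + (bk k i * H p + beta i p * Hd k))) (axis k 1, 0) p"
  unfolding X_def[abs_def] by (intro has_dir_deriv_add has_dir_deriv_mult has_dir_deriv_cmult has_dir_deriv_W has_dir_deriv_Av has_dir_deriv_beta has_dir_deriv_H)

lemma h_sym: "h i k = h k i"
  by (simp add: h_def dphix_def uxx_sym[of i k] algebra_simps)

text \<open>Symmetry of \<open>A\<close> merges the two terms with second derivatives of
  \<open>v\<close> into one, the shape required by the commutator identity; the same happens in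
  \<open>Ht_eq\<close>.\<close>

lemma Hd_eq: "Hd k = (\<Sum>i\<in>UNIV. \<Sum>j\<in>UNIV. ak k i j * vx i p * vx j p) + 2 * (\<Sum>j\<in>UNIV. W j p * h k j)
    - qd k * (v p)\<^sup>2 - 2 * q p * v p * vx k p"
proof -
  have "(\<Sum>i\<in>UNIV. \<Sum>j\<in>UNIV. A p $ i $ j * h k j * vx i p) = (\<Sum>j\<in>UNIV. W j p * h k j)"
    unfolding W_def by (subst sum.swap) (simp add: sum_distrib_left sum_distrib_right A_sym mult_ac)
  thus ?thesis unfolding Hd_def dW_def
    by (simp add: sum.distrib sum_distrib_left sum_distrib_right algebra_simps power2_eq_square)
qed

lemma Ht_eq: "Ht = (\<Sum>i\<in>UNIV. \<Sum>j\<in>UNIV. adt i j * vx i p * vx j p) + 2 * (\<Sum>j\<in>UNIV. W j p * ht j)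
    - qt * (v p)\<^sup>2 - 2 * q p * v p * vt p"
proof -
  have "(\<Sum>i\<in>UNIV. \<Sum>j\<in>UNIV. A p $ i $ j * ht j * vx i p) = (\<Sum>j\<in>UNIV. W j p * ht j)"
    unfolding W_def by (subst sum.swap) (simp add: sum_distrib_left sum_distrib_right A_sym mult_ac)
  thus ?thesis unfolding Ht_def Wt_def
    by (simp add: sum.distrib sum_distrib_left sum_distrib_right algebra_simps power2_eq_square)
qed

end

subsection \<open>The pointwise inequality\<close>

lemma sum_axis_eq: "(\<Sum>i\<in>UNIV. \<Sum>j\<in>UNIV. A $ i $ j * axis k (c::real) $ i * axis l d $ j) = A $ k $ l * c * d"
  for A :: "real^'n::finite^'n"
proof -
  have "(\<Sum>j\<in>UNIV. A $ i $ j * axis k c $ i * axis l d $ j) = A $ i $ l * axis k c $ i * d" for i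
    by (subst sum.remove[of _ l]) (auto simp: axis_def intro!: sum.neutral)
  hence "(\<Sum>i\<in>UNIV. \<Sum>j\<in>UNIV. A $ i $ j * axis k c $ i * axis l d $ j) = (\<Sum>i\<in>UNIV. A $ i $ l * axis k c $ i * d)"
    by simp
  also have "\<dots> = A $ k $ l * c * d"
    by (subst sum.remove[of _ k]) (auto simp: axis_def intro!: sum.neutral)
  finally show ?thesis .
qed

text \<open>Polarization: at the sum and the difference of two unit vectors the form yields
  \<open>2 * \<bar>A $ k $ l\<bar> \<le> A $ k $ k + A $ l $ l\<close>, and each diagonal entry is a
  value of the form.\<close>

lemma quadratic_form_entry_bound:
  fixes A :: "real^'n::finite^'n"
  assumes sym: "\<And>i j. A $ i $ j = A $ j $ i"
    and bd: "\<And>\<xi>::real^'n. 0 \<le> (\<Sum>i\<in>UNIV. \<Sum>j\<in>UNIV. A $ i $ j * \<xi> $ i * \<xi> $ j)"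
      "\<And>\<xi>::real^'n. (\<Sum>i\<in>UNIV. \<Sum>j\<in>UNIV. A $ i $ j * \<xi> $ i * \<xi> $ j) \<le> Lam * (norm \<xi>)\<^sup>2"
  shows "\<bar>A $ k $ l\<bar> \<le> Lam"
proof -
  define Q where "Q \<xi> = (\<Sum>i\<in>UNIV. \<Sum>j\<in>UNIV. A $ i $ j * \<xi> $ i * \<xi> $ j)" for \<xi> :: "real^'n"
  have Q: "Q (axis k 1 + axis l c) = A $ k $ k + 2 * c * A $ k $ l + c * c * A $ l $ l" for c
  proof -
    have "Q (axis k 1 + axis l c) =
        (\<Sum>i\<in>UNIV. \<Sum>j\<in>UNIV. A $ i $ j * axis k 1 $ i * axis k 1 $ j)
      + (\<Sum>i\<in>UNIV. \<Sum>j\<in>UNIV. A $ i $ j * axis k 1 $ i * axis l c $ j)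
      + (\<Sum>i\<in>UNIV. \<Sum>j\<in>UNIV. A $ i $ j * axis l c $ i * axis k 1 $ j)
      + (\<Sum>i\<in>UNIV. \<Sum>j\<in>UNIV. A $ i $ j * axis l c $ i * axis l c $ j)"
      unfolding Q_def by (simp add: algebra_simps sum.distrib)
    also have "\<dots> = A $ k $ k + 2 * c * A $ k $ l + c * c * A $ l $ l"
      unfolding sum_axis_eq using sym[of l k] by simp
    finally show ?thesis .
  qed
  have d: "0 \<le> A $ m $ m" "A $ m $ m \<le> Lam" for m
    using bd[of "axis m 1"] unfolding sum_axis_eq by auto
  have "2 * \<bar>A $ k $ l\<bar> \<le> A $ k $ k + A $ l $ l"
    using bd(1)[of "axis k 1 + axis l 1"] bd(1)[of "axis k 1 + axis l (-1)"]
      Q[of 1] Q[of "-1"] unfolding Q_def by (simp add: abs_le_iff)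
  thus ?thesis using d[of k] d[of l] by linarith
qed

text \<open>Applied with the two brackets as \<open>a\<close>, \<open>b\<close> and the error
  \<open>(f - div \<beta>) v\<close> as \<open>c\<close>, so that only the cross term is kept. The
  doubled difference is a sum of two squares.\<close>

lemma square_sum_lower_bound: "(a + b + c)\<^sup>2 \<ge> 2 * a * b - c\<^sup>2" for a b c :: real
proof -
  have "2 * ((a + b + c)\<^sup>2 - (2 * a * b - c\<^sup>2)) = (a + b + 2 * c)\<^sup>2 + (a - b)\<^sup>2"
    by (simp add: power2_eq_square algebra_simps)
  thus ?thesis by (smt (verit) zero_le_power2)
qed

context carleman_point
begin

lemma dphix_sum: "(\<Sum>j\<in>UNIV. y j * dphix k j) = - y k * (b / t)"
proof -
  have "(\<Sum>j\<in>UNIV. y j * dphix k j) = (\<Sum>j\<in>UNIV. if j = k then y j * (- b / t) else 0)"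
    by (intro sum.cong) (auto simp: dphix_def)
  also have "\<dots> = - y k * (b / t)" by (subst sum.delta) auto
  finally show ?thesis .
qed

text \<open>With \<open>e^\<phi> \<nabla>u = \<nabla>v - v \<nabla>\<phi>\<close>, the drift
  \<open>\<beta> \<cdot> \<nabla>v\<close> appears twice, once through the symmetry of
  \<open>A\<close>, and its zeroth-order companion is \<open>- (div \<beta>) v\<close>. Adding and
  subtracting \<open>f v\<close> completes the splitting.\<close>

lemma conjugated_operator:
  "om p * parabolic_op A u p = (\<Sum>i\<in>UNIV. dW i i) + q p * v p + Av p + (k1 / t - (\<Sum>i\<in>UNIV. bk i i)) * v p"
proof -
  have P: "parabolic_op A u p = d_t u p + (\<Sum>i\<in>UNIV. \<Sum>j\<in>UNIV. ak i i j * d_x j u p + A p $ i $ j * uxx i j)"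
    unfolding parabolic_op_def d_x_def
    by (intro arg_cong2[where f = "(+)"] refl sum.cong dir_deriv_eqI has_dir_deriv_mult has_dir_deriv_A has_dir_deriv_ux[unfolded d_x_def])
  have 1: "om p * (ak i i j * d_x j u p + A p $ i $ j * uxx i j) =
      (ak i i j * vx j p + A p $ i $ j * h i j) - (ak i i j * phix j p + A p $ i $ j * dphix i j) * v p
      - A p $ i $ j * phix i p * vx j p - A p $ i $ j * phix j p * vx i p + A p $ i $ j * phix j p * phix i p * v p" for i j
    by (simp add: h_def vx_def v_def algebra_simps)
  have 2: "(\<Sum>i\<in>UNIV. \<Sum>j\<in>UNIV. A p $ i $ j * phix i p * vx j p) = (\<Sum>k\<in>UNIV. beta k p * vx k p)"
    unfolding beta_def by (subst sum.swap) (simp add: sum_distrib_right A_sym)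
  have 3: "(\<Sum>i\<in>UNIV. \<Sum>j\<in>UNIV. A p $ i $ j * phix j p * vx i p) = (\<Sum>k\<in>UNIV. beta k p * vx k p)"
    unfolding beta_def by (simp add: sum_distrib_right)
  have 4: "(\<Sum>i\<in>UNIV. \<Sum>j\<in>UNIV. A p $ i $ j * phix j p * phix i p * v p) = (\<Sum>k\<in>UNIV. phix k p * beta k p) * v p"
    unfolding beta_def by (simp add: sum_distrib_right sum_distrib_left mult_ac)
  have "om p * (\<Sum>i\<in>UNIV. \<Sum>j\<in>UNIV. ak i i j * d_x j u p + A p $ i $ j * uxx i j)
      = (\<Sum>i\<in>UNIV. \<Sum>j\<in>UNIV. om p * (ak i i j * d_x j u p + A p $ i $ j * uxx i j))"
    by (simp add: sum_distrib_left)
  also have "\<dots> = (\<Sum>i\<in>UNIV. \<Sum>j\<in>UNIV. ak i i j * vx j p + A p $ i $ j * h i j)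
      - (\<Sum>i\<in>UNIV. \<Sum>j\<in>UNIV. (ak i i j * phix j p + A p $ i $ j * dphix i j) * v p)
      - (\<Sum>i\<in>UNIV. \<Sum>j\<in>UNIV. A p $ i $ j * phix i p * vx j p)
      - (\<Sum>i\<in>UNIV. \<Sum>j\<in>UNIV. A p $ i $ j * phix j p * vx i p)
      + (\<Sum>i\<in>UNIV. \<Sum>j\<in>UNIV. A p $ i $ j * phix j p * phix i p * v p)"
    unfolding 1 by (simp only: sum_subtractf sum.distrib)
  also have "\<dots> = (\<Sum>i\<in>UNIV. dW i i) - (\<Sum>i\<in>UNIV. bk i i) * v p
      - 2 * (\<Sum>k\<in>UNIV. beta k p * vx k p) + (\<Sum>k\<in>UNIV. phix k p * beta k p) * v p"
    unfolding 2 3 4 by (simp add: dW_def bk_def sum_distrib_right)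
  finally show ?thesis unfolding P distrib_left
    by (simp add: Av_def q_def vt_def v_def algebra_simps)
qed

end

text \<open>The constants form a chain: \<open>C1 / t\<close> bounds the entries of
  \<open>\<nabla>\<beta>\<close>, \<open>C2 / t\<close> those of the derivative of \<open>A\<close>
  along \<open>\<partial>\<^sub>t - 2 \<beta> \<cdot> \<nabla>\<close>, \<open>C3\<close> the
  unsigned terms on the scale \<open>N\<^sup>2 / t\<close>, and \<open>C4\<close> the term
  \<open>2 \<beta> \<cdot> \<nabla>q\<close> on the scale \<open>r / t\<close>. Then
  \<open>k1\<close> is large against these and \<open>K\<close> large against \<open>k1\<close>. The
  product form of \<open>ak_bound\<close> stays meaningful at \<open>x = 0\<close>.\<close>

locale carleman_bounds = carleman_point A u b K \<gamma> k1 p ak adt uxx uxt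
  for A :: "(real^'n::finite) \<times> real \<Rightarrow> real^'n^'n" and u b K \<gamma> k1 p ak adt uxx uxt +
  fixes lam Lam M E n C1 C2 C3 C4 :: real
  assumes pos: "0 < lam" "lam \<le> Lam" "0 < M" "0 < E" "0 < \<gamma>"
    and t2: "snd p < 2"
    and elliptic: "\<And>\<xi>::real^'n. lam * (norm \<xi>)\<^sup>2 \<le> (\<Sum>i\<in>UNIV. \<Sum>j\<in>UNIV. A p $ i $ j * \<xi> $ i * \<xi> $ j)"
      "\<And>\<xi>::real^'n. (\<Sum>i\<in>UNIV. \<Sum>j\<in>UNIV. A p $ i $ j * \<xi> $ i * \<xi> $ j) \<le> Lam * (norm \<xi>)\<^sup>2"
    and ak_bound: "\<And>k i j. \<bar>ak k i j\<bar> * norm (fst p) \<le> E"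
    and adt_bound: "\<And>i j. \<bar>adt i j\<bar> \<le> M"
    and b: "b = 1 / (8 * Lam)" and n: "n = real CARD('n)"
    and C1: "C1 = b * (Lam + n * E)" and C2: "C2 = 2 * M + 2 * n\<^sup>2 * Lam * b * E"
    and C3: "C3 = 2 * n * C1 * Lam + 4 * n ^ 3 * Lam * C1 + n\<^sup>2 * C2"
    and C4: "C4 = 2 * n\<^sup>2 * Lam * b * (n * Lam * b + n * C1 + 1)"
    and k1_large: "C3 + 4 \<le> 2 * k1 * lam" "n * C1 + 2 \<le> k1"
      "4 * b \<le> 3 * k1 / 4 - 1 - 2 * n\<^sup>2 * M * b - C4 - n * C1"
    and K_large: "8 + 2 * (k1 + n * C1)\<^sup>2 \<le> K" "2 * k1 + 2 * (n * C1) \<le> K + 1"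
begin

section \<open>Size of the terms at the point\<close>

abbreviation "nx \<equiv> norm x"

text \<open>\<open>N\<close> is \<open>|\<nabla>v|\<close>, \<open>r\<close> equals
  \<open>|\<nabla>\<phi>|\<^sup>2 / b\<close>, \<open>s\<close> is
  \<open>A \<nabla>\<phi> \<cdot> \<nabla>\<phi>\<close>, \<open>g\<close> is the part of
  \<open>- \<partial>\<^sub>t \<phi>\<close> that carries \<gamma>, and \<open>d\<close> is
  \<open>div \<beta>\<close>.\<close>

definition "N = norm (\<chi> i. vx i p)"
definition "r = b * nx\<^sup>2 / t\<^sup>2"
definition "s = (\<Sum>i\<in>UNIV. phix i p * beta i p)"
definition "g = \<gamma> * K * t powr (- K - 1)"
definition "d = (\<Sum>i\<in>UNIV. bk i i)"

lemma b0: "0 < b" using pos b by simp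

lemma n1: "1 \<le> n"
  unfolding n using card_gt_0_iff[of "UNIV :: 'n set"] by (simp add: Suc_le_eq)

lemma Lam0: "0 < Lam" using pos by simp

lemma C1_nonneg: "0 \<le> C1" unfolding C1 using b0 Lam0 n1 pos by simp

lemma K0: "0 \<le> K" using K_large(1) zero_le_power2[of "k1 + n * C1"] by linarith

lemma inverse_t: "1 \<le> 2 / t" using t0 t2 by (simp add: field_simps)

lemma quad_nonneg: "0 \<le> (\<Sum>i\<in>UNIV. \<Sum>j\<in>UNIV. A p $ i $ j * \<xi> $ i * \<xi> $ j)" for \<xi> :: "real^'n"
  using elliptic(1)[of \<xi>] pos by (smt (verit) mult_nonneg_nonneg zero_le_power2)

lemma A_bound: "\<bar>A p $ i $ j\<bar> \<le> Lam"
  by (rule quadratic_form_entry_bound[OF A_sym quad_nonneg elliptic(2)])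

lemma phix_bound: "\<bar>phix i p\<bar> \<le> b * nx / t"
  using t0 b0 component_le_norm_cart[of x i]
  by (simp add: phix_def abs_mult divide_right_mono)

lemma vx_bound: "\<bar>vx i p\<bar> \<le> N"
  using component_le_norm_cart[of "\<chi> i. vx i p" i] by (simp add: N_def)

lemma beta_bound: "\<bar>beta i p\<bar> \<le> n * (Lam * (b * nx / t))"
  unfolding beta_def n by (rule linear_sum_bound[OF A_bound phix_bound])

lemma W_bound: "\<bar>W i p\<bar> \<le> n * (Lam * N)"
  unfolding W_def n by (rule linear_sum_bound[OF A_bound vx_bound])

text \<open>\<open>\<nabla>\<phi>\<close> grows like \<open>b |x| / t\<close>, and the factor
  \<open>|x|\<close> is absorbed by \<open>|x| |\<nabla>A| \<le> E\<close>; the Hessian of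
  \<open>\<phi>\<close> adds only \<open>Lam * b / t\<close>.\<close>

lemma bk_bound: "\<bar>bk k i\<bar> \<le> C1 / t"
proof -
  have 1: "\<bar>ak k i j * phix j p\<bar> \<le> E * b / t" for j
  proof -
    have "\<bar>ak k i j * phix j p\<bar> \<le> \<bar>ak k i j\<bar> * (b * nx / t)"
      unfolding abs_mult by (intro mult_left_mono phix_bound) auto
    also have "\<dots> = (\<bar>ak k i j\<bar> * nx) * (b / t)" by simp
    also have "\<dots> \<le> E * (b / t)" using b0 t0 by (intro mult_right_mono ak_bound) auto
    finally show ?thesis by simp
  qed
  have "\<bar>\<Sum>j\<in>UNIV. ak k i j * phix j p * 1\<bar> \<le> n * (E * b / t * 1)"
    unfolding n by (intro linear_sum_bound 1) auto
  moreover have "\<bar>A p $ i $ k * (b / t)\<bar> \<le> Lam * (b / t)"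
    unfolding abs_mult using b0 t0 Lam0 by (intro mult_mono A_bound) auto
  ultimately have "\<bar>bk k i\<bar> \<le> n * (E * b / t) + Lam * (b / t)"
    unfolding bk_def sum.distrib dphix_sum mult_minus_left mult_1_right by linarith
  thus ?thesis by (simp add: C1 algebra_simps add_divide_distrib)
qed

lemma d_bound: "\<bar>d\<bar> \<le> n * C1 / t"
  using linear_sum_bound[of "\<lambda>i. bk i i" "C1 / t" "\<lambda>_. 1" 1] bk_bound by (simp add: d_def n)

lemma sum_phix_sq: "(\<Sum>i\<in>UNIV. (phix i p)\<^sup>2) = b * r"
proof -
  have "(\<Sum>i\<in>UNIV. (phix i p)\<^sup>2) = (\<Sum>i\<in>UNIV. b\<^sup>2 / t\<^sup>2 * (x $ i)\<^sup>2)"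
    by (simp add: phix_def power_mult_distrib power_divide)
  also have "\<dots> = b\<^sup>2 / t\<^sup>2 * (\<Sum>i\<in>UNIV. (x $ i)\<^sup>2)" by (rule sum_distrib_left[symmetric])
  also have "\<dots> = b\<^sup>2 / t\<^sup>2 * nx\<^sup>2" by (simp add: norm_vec_def L2_set_def sum_nonneg)
  finally show ?thesis by (simp add: r_def power2_eq_square)
qed

lemma norm_sq_eq_sum: "(norm (\<chi> i. y i))\<^sup>2 = (\<Sum>i\<in>UNIV. (y i)\<^sup>2)" for y :: "'n \<Rightarrow> real"
  by (simp add: norm_vec_def L2_set_def sum_nonneg)

text \<open>Here the value of \<open>b\<close> enters: \<open>Lam * b = 1 / 8\<close> keeps
  \<open>s\<close> well below the \<open>r / 2\<close> that occurs in \<open>q\<close> with the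
  opposite sign.\<close>

lemma s_bounds: "0 \<le> s" "s \<le> r / 8"
proof -
  have s: "s = (\<Sum>i\<in>UNIV. \<Sum>j\<in>UNIV. A p $ i $ j * (\<chi> i. phix i p) $ i * (\<chi> i. phix i p) $ j)"
    by (simp add: s_def beta_def sum_distrib_left mult_ac)
  show "0 \<le> s" unfolding s by (rule quad_nonneg)
  have "s \<le> Lam * (norm (\<chi> i. phix i p))\<^sup>2" unfolding s by (rule elliptic(2))
  also have "\<dots> = (Lam * b) * r" by (simp add: norm_sq_eq_sum sum_phix_sq)
  also have "Lam * b = 1 / 8" using Lam0 b by simp
  finally show "s \<le> r / 8" by simp
qed

lemma r0: "0 \<le> r" using b0 by (simp add: r_def)

lemma g0: "0 \<le> g" using pos K0 by (simp add: g_def)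

lemma q_eq: "q p = g - K / (2 * t\<^sup>2) - r / 2 + s"
  by (simp add: q_def s_def phit_def g_def r_def power2_eq_square add_divide_distrib algebra_simps)

lemma bxt: "b * x $ i / t\<^sup>2 = - phix i p / t"
  by (simp add: phix_def power2_eq_square)

text \<open>Since the time derivative of \<open>phix i\<close> is \<open>- phix i / t\<close>, the
  weight contributes \<open>- 2 * s / t\<close> to the derivative of \<open>s\<close>, which has a
  good sign and is dropped; the rest comes from the time derivative of \<open>A\<close> and is of
  size \<open>M |\<nabla>\<phi>|\<^sup>2\<close>.\<close>

lemma qt_bound: "qt \<le> - (K + 1) * g / t + K / t ^ 3 + r / t + 2 * n\<^sup>2 * M * b * r / t"
proof -
  define m where "m = (\<Sum>i\<in>UNIV. \<Sum>j\<in>UNIV. adt i j * phix i p * phix j p)"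
  have "\<bar>m\<bar> \<le> n\<^sup>2 * (M * (b * nx / t) * (b * nx / t))"
    unfolding m_def n by (rule bilinear_sum_bound[OF adt_bound phix_bound phix_bound])
  also have "\<dots> = n\<^sup>2 * M * b * r" by (simp add: r_def power2_eq_square)
  \<comment> \<open>\<open>t < 2\<close> supplies the factor \<open>1 / t\<close> of the common
    scale.\<close>
  also have "\<dots> \<le> n\<^sup>2 * M * b * r * (2 / t)"
    using mult_left_mono[OF inverse_t, of "n\<^sup>2 * M * b * r"] pos b0 r0 by simp
  finally have m: "m \<le> 2 * n\<^sup>2 * M * b * r / t" by (simp add: mult_ac)
  have bt: "bt i = (\<Sum>j\<in>UNIV. adt i j * phix j p) - beta i p / t" for i
    unfolding bt_def bxt beta_def by (simp add: sum_subtractf sum_divide_distrib)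
  have "(\<Sum>i\<in>UNIV. phix i p * bt i) = m - s / t"
    unfolding bt m_def s_def
    by (simp add: algebra_simps sum_subtractf sum_distrib_left sum_divide_distrib)
  moreover have "(\<Sum>i\<in>UNIV. b * x $ i / t\<^sup>2 * beta i p) = - (s / t)"
    unfolding bxt s_def by (simp add: sum_negf sum_divide_distrib)
  moreover have "\<gamma> * K * (K + 1) * t powr (- K - 2) = (K + 1) * g / t"
  proof -
    have "- K - 2 = (- K - 1) - 1" by simp
    hence "t powr (- K - 2) = t powr (- K - 1) / t" using t0 by (simp only: powr_diff powr_one)
    thus ?thesis by (simp add: g_def)
  qed
  moreover have "(b * nx\<^sup>2 + K) / t ^ 3 = r / t + K / t ^ 3"
    by (simp add: r_def add_divide_distrib power2_eq_square power3_eq_cube)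
  moreover have "0 \<le> s / t" using s_bounds t0 by simp
  moreover have "- (K + 1) * g / t = - ((K + 1) * g / t)" by (simp only: mult_minus_left minus_divide_left)
  ultimately show ?thesis unfolding qt_def sum.distrib using m by linarith
qed

text \<open>\<open>\<beta>\<close> is of order \<open>|x| / t\<close> and \<open>\<nabla>q\<close>
  of order \<open>|x| / t\<^sup>2\<close>, the latter since \<open>\<nabla>\<beta>\<close> is of
  order \<open>1 / t\<close>; their product is of order \<open>r / t\<close>.\<close>

lemma beta_qd_bound: "\<bar>2 * (\<Sum>k\<in>UNIV. beta k p * qd k)\<bar> \<le> C4 * r / t"
proof -
  have qd: "\<bar>qd k\<bar> \<le> b * nx / t\<^sup>2 * (n * Lam * b + n * C1 + 1)" for k
  proof -
    have "\<bar>\<Sum>i\<in>UNIV. bk k i * phix i p\<bar> \<le> n * (C1 / t * (b * nx / t))"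
      unfolding n by (rule linear_sum_bound[OF bk_bound phix_bound])
    moreover have "\<bar>beta k p * (b / t)\<bar> \<le> n * (Lam * (b * nx / t)) * (b / t)"
      unfolding abs_mult using b0 t0 by (intro mult_mono beta_bound) (use b0 t0 n1 Lam0 in auto)
    moreover have "\<bar>phix k p / t\<bar> \<le> b * nx / t / t"
      unfolding abs_divide using t0 by (intro frac_le phix_bound) (auto intro: order_trans[OF _ phix_bound])
    moreover have "qd k = (\<Sum>i\<in>UNIV. bk k i * phix i p) - beta k p * (b / t) + phix k p / t"
      unfolding qd_def sum.distrib bxt
      using dphix_sum[of "\<lambda>i. beta i p" k] by (simp add: mult.commute)
    ultimately have "\<bar>qd k\<bar> \<le> n * (C1 / t * (b * nx / t)) + n * (Lam * (b * nx / t)) * (b / t) + b * nx / t / t"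
      by linarith
    thus ?thesis by (simp add: algebra_simps power2_eq_square add_divide_distrib)
  qed
  have "\<bar>\<Sum>k\<in>UNIV. beta k p * qd k\<bar> \<le> n * (n * (Lam * (b * nx / t)) * (b * nx / t\<^sup>2 * (n * Lam * b + n * C1 + 1)))"
    using linear_sum_bound[OF beta_bound qd] by (simp add: n)
  also have "\<dots> = C4 * r / t / 2" by (simp add: C4 r_def power2_eq_square)
  finally show ?thesis by (simp add: abs_mult)
qed

lemma zeroth_order_terms:
  "1 + 2 * b * r \<le> 2 * d * q p - 2 * (k1 / t) * q p - (qt - 2 * (\<Sum>k\<in>UNIV. beta k p * qd k)) - (k1 / t - d)\<^sup>2"
  \<comment> \<open>Instantiated with \<open>c1 = 2 * n\<^sup>2 * M * b\<close> and
    \<open>D = n * C1\<close>.\<close>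
  by (rule zeroth_order_coefficient_bound[OF t0 t2 g0 r0 s_bounds q_eq qt_bound beta_qd_bound d_bound
        k1_large(2,3) less_imp_le[OF b0] K_large])

definition "G = (\<Sum>i\<in>UNIV. W i p * vx i p)"

lemma G_bounds: "lam * N\<^sup>2 \<le> G" "G \<le> Lam * N\<^sup>2"
proof -
  have G: "G = (\<Sum>i\<in>UNIV. \<Sum>j\<in>UNIV. A p $ i $ j * (\<chi> i. vx i p) $ i * (\<chi> i. vx i p) $ j)"
    by (simp add: G_def W_def sum_distrib_left mult_ac)
  show "lam * N\<^sup>2 \<le> G" "G \<le> Lam * N\<^sup>2" unfolding G N_def by (rule elliptic)+
qed

text \<open>Ellipticity makes the term with \<open>k1\<close> at least
  \<open>2 * k1 * lam * N\<^sup>2 / t\<close>, and all other terms together are at most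
  \<open>C3 * N\<^sup>2 / t\<close>.\<close>

lemma first_order_terms:
  "2 * N\<^sup>2 \<le> (2 * (k1 / t) - 2 * d) * G + 4 * (\<Sum>i\<in>UNIV. \<Sum>k\<in>UNIV. bk i k * W i p * vx k p)
      + ((\<Sum>i\<in>UNIV. \<Sum>j\<in>UNIV. adt i j * vx i p * vx j p)
        - 2 * (\<Sum>k\<in>UNIV. beta k p * (\<Sum>i\<in>UNIV. \<Sum>j\<in>UNIV. ak k i j * vx i p * vx j p)))"
proof -
  have N0: "0 \<le> N" by (simp add: N_def)
  have k10: "0 \<le> k1" using k1_large(2) n1 C1_nonneg by (smt (verit) mult_nonneg_nonneg)
  \<comment> \<open>\<open>Da\<close> is the derivative of \<open>A\<close> along
    \<open>\<partial>\<^sub>t - 2 \<beta> \<cdot> \<nabla>\<close>; the growth of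
    \<open>\<beta>\<close> in \<open>|x|\<close> is compensated by the decay of
    \<open>\<nabla>A\<close>.\<close>
  define Da where "Da i j = adt i j - 2 * (\<Sum>k\<in>UNIV. beta k p * ak k i j)" for i j
  have Da: "\<bar>Da i j\<bar> \<le> C2 / t" for i j
  proof -
    have 1: "\<bar>beta k p * ak k i j\<bar> \<le> n * Lam * b * E / t" for k
    proof -
      have "\<bar>beta k p * ak k i j\<bar> \<le> n * (Lam * (b * nx / t)) * \<bar>ak k i j\<bar>"
        unfolding abs_mult by (intro mult_right_mono beta_bound) auto
      also have "\<dots> = n * Lam * b / t * (\<bar>ak k i j\<bar> * nx)" by simp
      also have "\<dots> \<le> n * Lam * b / t * E" using n1 Lam0 b0 t0 by (intro mult_left_mono ak_bound) auto
      finally show ?thesis by simp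
    qed
    have "\<bar>\<Sum>k\<in>UNIV. beta k p * ak k i j * 1\<bar> \<le> n * (n * Lam * b * E / t * 1)"
      unfolding n using 1[unfolded n] by (intro linear_sum_bound) auto
    moreover have "M \<le> M * (2 / t)" using mult_left_mono[OF inverse_t, of M] pos by simp
    ultimately have "\<bar>Da i j\<bar> \<le> M * (2 / t) + 2 * (n * (n * Lam * b * E / t))"
      using adt_bound[of i j] unfolding Da_def by simp
    thus ?thesis by (simp add: C2 add_divide_distrib power2_eq_square mult_ac)
  qed
  have "(\<Sum>k\<in>UNIV. beta k p * (\<Sum>i\<in>UNIV. \<Sum>j\<in>UNIV. ak k i j * vx i p * vx j p))
      = (\<Sum>i\<in>UNIV. \<Sum>j\<in>UNIV. (\<Sum>k\<in>UNIV. beta k p * ak k i j) * vx i p * vx j p)"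
  proof -
    have "(\<Sum>k\<in>UNIV. beta k p * (\<Sum>i\<in>UNIV. \<Sum>j\<in>UNIV. ak k i j * vx i p * vx j p))
        = (\<Sum>k\<in>UNIV. \<Sum>i\<in>UNIV. \<Sum>j\<in>UNIV. beta k p * ak k i j * vx i p * vx j p)"
      by (simp add: sum_distrib_left mult.assoc)
    also have "\<dots> = (\<Sum>i\<in>UNIV. \<Sum>k\<in>UNIV. \<Sum>j\<in>UNIV. beta k p * ak k i j * vx i p * vx j p)"
      by (rule sum.swap)
    also have "\<dots> = (\<Sum>i\<in>UNIV. \<Sum>j\<in>UNIV. \<Sum>k\<in>UNIV. beta k p * ak k i j * vx i p * vx j p)"
      by (intro sum.cong refl sum.swap)
    finally show ?thesis by (simp add: sum_distrib_right)
  qed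
  note swap = this
  have e: "Da i j * vx i p * vx j p = adt i j * vx i p * vx j p
      - 2 * ((\<Sum>k\<in>UNIV. beta k p * ak k i j) * vx i p * vx j p)" for i j
    unfolding Da_def by (simp add: left_diff_distrib)
  have 1: "(\<Sum>i\<in>UNIV. \<Sum>j\<in>UNIV. adt i j * vx i p * vx j p)
        - 2 * (\<Sum>k\<in>UNIV. beta k p * (\<Sum>i\<in>UNIV. \<Sum>j\<in>UNIV. ak k i j * vx i p * vx j p))
      = (\<Sum>i\<in>UNIV. \<Sum>j\<in>UNIV. Da i j * vx i p * vx j p)"
    by (simp only: e swap sum_subtractf sum_distrib_left[symmetric])
  have 2: "\<bar>\<Sum>i\<in>UNIV. \<Sum>j\<in>UNIV. Da i j * vx i p * vx j p\<bar> \<le> n\<^sup>2 * (C2 / t * N * N)"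
    unfolding n by (rule bilinear_sum_bound[OF Da vx_bound vx_bound])
  have 3: "\<bar>\<Sum>i\<in>UNIV. \<Sum>k\<in>UNIV. bk i k * W i p * vx k p\<bar> \<le> n\<^sup>2 * (C1 / t * (n * (Lam * N)) * N)"
    using bilinear_sum_bound[OF bk_bound W_bound vx_bound] by (simp add: n)
  have G0: "0 \<le> G" using G_bounds(1) pos by (smt (verit) mult_nonneg_nonneg zero_le_power2)
  have 4: "\<bar>d * G\<bar> \<le> n * C1 / t * (Lam * N\<^sup>2)"
    unfolding abs_mult using d_bound G_bounds G0 by (intro mult_mono) (auto intro: order_trans[OF _ d_bound])
  have 5: "k1 / t * (lam * N\<^sup>2) \<le> k1 / t * G" using k10 t0 G_bounds by (intro mult_left_mono) auto
  \<comment> \<open>The surplus 4 in the lower bound for \<open>k1\<close> yields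
    \<open>4 * N\<^sup>2 / t\<close>, which is at least \<open>2 * N\<^sup>2\<close> as
    \<open>t < 2\<close>.\<close>
  have "2 * N\<^sup>2 \<le> 2 * N\<^sup>2 * (2 / t)" using mult_left_mono[OF inverse_t, of "2 * N\<^sup>2"] by simp
  also have "\<dots> \<le> (2 * k1 * lam - C3) * (N\<^sup>2 / t)"
    using mult_right_mono[of 4 "2 * k1 * lam - C3" "N\<^sup>2 / t"] k1_large(1) t0 by simp
  also have "\<dots> = 2 * (k1 / t * (lam * N\<^sup>2)) - 2 * (n * C1 / t * (Lam * N\<^sup>2))
      - 4 * (n\<^sup>2 * (C1 / t * (n * (Lam * N)) * N)) - n\<^sup>2 * (C2 / t * N * N)"
    by (simp add: C3 algebra_simps power2_eq_square power3_eq_cube add_divide_distrib diff_divide_distrib)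
  also have "\<dots> \<le> 2 * (k1 / t * G) - 2 * (d * G) + 4 * (\<Sum>i\<in>UNIV. \<Sum>k\<in>UNIV. bk i k * W i p * vx k p)
      + (\<Sum>i\<in>UNIV. \<Sum>j\<in>UNIV. Da i j * vx i p * vx j p)"
    using 2 3 4 5 by linarith
  finally show ?thesis unfolding 1 by (simp add: left_diff_distrib)
qed

text \<open>The squared conjugated operator is bounded below by its cross term less the squared
  error; the commutator identity turns the cross term into signed terms and a divergence, and the
  two absorption estimates leave room for \<open>u\<close> and its gradient.\<close>

lemma pointwise_carleman:
  "(om p)\<^sup>2 * ((u p)\<^sup>2 + (\<Sum>i\<in>UNIV. (d_x i u p)\<^sup>2))
    + ((\<Sum>i\<in>UNIV. 2 * ((dW i i * Av p + W i p * dAv i) + (bk i i * H p + beta i p * Hd i))) - Ht)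
    \<le> (om p * parabolic_op A u p)\<^sup>2"
proof -
  define S where "S = (\<Sum>i\<in>UNIV. dW i i)"
  define DIV where "DIV = (\<Sum>i\<in>UNIV. 2 * ((dW i i * Av p + W i p * dAv i) + (bk i i * H p + beta i p * Hd i))) - Ht"
  have DIV: "DIV = 2 * S * Av p + 2 * (\<Sum>i\<in>UNIV. W i p * dAv i) + 2 * d * H p
      + 2 * (\<Sum>i\<in>UNIV. beta i p * Hd i) - Ht"
    by (simp add: DIV_def S_def d_def sum.distrib sum_distrib_left sum_distrib_right algebra_simps)
  define Z where "Z = 2 * d * q p - 2 * (k1 / t) * q p - (qt - 2 * (\<Sum>k\<in>UNIV. beta k p * qd k))"
  have "2 * (S + q p * v p) * Av p - DIV
    = (2 * (k1 / t) - 2 * d) * G + 4 * (\<Sum>i\<in>UNIV. \<Sum>k\<in>UNIV. bk i k * W i p * vx k p)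
      + ((\<Sum>i\<in>UNIV. \<Sum>j\<in>UNIV. adt i j * vx i p * vx j p)
        - 2 * (\<Sum>k\<in>UNIV. beta k p * (\<Sum>i\<in>UNIV. \<Sum>j\<in>UNIV. ak k i j * vx i p * vx j p)))
      + Z * (v p)\<^sup>2"
    unfolding DIV Z_def
    by (rule carleman_commutator_identity[OF h_sym _ dAv_def _ G_def Hd_eq Ht_eq d_def])
      (simp_all add: Av_def H_def G_def power2_eq_square)
  \<comment> \<open>The squared error \<open>(k1 / t - d)\<^sup>2\<close> is already paid for in the
    zeroth-order estimate.\<close>
  moreover have "(1 + 2 * b * r) * (v p)\<^sup>2 \<le> (Z - (k1 / t - d)\<^sup>2) * (v p)\<^sup>2"
    unfolding Z_def by (intro mult_right_mono zeroth_order_terms) auto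
  moreover have "(Z - (k1 / t - d)\<^sup>2) * (v p)\<^sup>2 = Z * (v p)\<^sup>2 - ((k1 / t - d) * v p)\<^sup>2"
    by (simp only: left_diff_distrib[of Z] power_mult_distrib)
  ultimately have 1: "2 * N\<^sup>2 + (1 + 2 * b * r) * (v p)\<^sup>2 + DIV
      \<le> 2 * (S + q p * v p) * Av p - ((k1 / t - d) * v p)\<^sup>2"
    using first_order_terms by linarith
  have 2: "2 * (S + q p * v p) * Av p - ((k1 / t - d) * v p)\<^sup>2 \<le> (om p * parabolic_op A u p)\<^sup>2"
    using square_sum_lower_bound[of "S + q p * v p" "Av p" "(k1 / t - d) * v p"]
    by (simp add: conjugated_operator S_def d_def)
  \<comment> \<open>Return from \<open>v\<close> to \<open>u\<close> by
    \<open>e^\<phi> \<nabla>u = \<nabla>v - v \<nabla>\<phi>\<close>; the factor 2 lost here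
    explains the reserved amounts \<open>2 * N\<^sup>2\<close> and \<open>2 * b * r\<close>.\<close>
  have "(om p * d_x i u p)\<^sup>2 \<le> 2 * (vx i p)\<^sup>2 + 2 * (v p)\<^sup>2 * (phix i p)\<^sup>2" for i
  proof -
    have e: "om p * d_x i u p = vx i p - phix i p * v p" by (simp add: vx_def v_def algebra_simps)
    have "2 * (vx i p)\<^sup>2 + 2 * (v p)\<^sup>2 * (phix i p)\<^sup>2 - (om p * d_x i u p)\<^sup>2 = (vx i p + phix i p * v p)\<^sup>2"
      unfolding e by (simp add: power2_eq_square algebra_simps)
    thus ?thesis using zero_le_power2[of "vx i p + phix i p * v p"] by linarith
  qed
  hence "(\<Sum>i\<in>UNIV. (om p * d_x i u p)\<^sup>2) \<le> (\<Sum>i\<in>UNIV. 2 * (vx i p)\<^sup>2 + 2 * (v p)\<^sup>2 * (phix i p)\<^sup>2)"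
    by (rule sum_mono)
  also have "\<dots> = 2 * N\<^sup>2 + 2 * (v p)\<^sup>2 * (b * r)"
    by (simp add: sum.distrib sum_distrib_left[symmetric] sum_phix_sq N_def norm_sq_eq_sum)
  finally have "(om p)\<^sup>2 * ((u p)\<^sup>2 + (\<Sum>i\<in>UNIV. (d_x i u p)\<^sup>2)) \<le> 2 * N\<^sup>2 + (1 + 2 * b * r) * (v p)\<^sup>2"
    by (simp add: power_mult_distrib sum_distrib_left v_def algebra_simps)
  thus ?thesis using 1 2 unfolding DIV_def[symmetric] by linarith
qed

end

subsection \<open>Integration\<close>

lemma C_infinity_differentiable: "C_infinity f \<Longrightarrow> f differentiable_on UNIV"
  unfolding C_infinity_def by (drule spec[of _ "[]"]) simp

lemma C_infinity_dir_deriv: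
  assumes "C_infinity f" "e \<in> Basis"
  shows "C_infinity (dir_deriv e f)"
  unfolding C_infinity_def
proof (intro allI impI)
  fix vs :: "'a list" assume "set vs \<subseteq> Basis"
  \<comment> \<open>\<open>foldr\<close> applies the last direction first, so \<open>e\<close> goes
    to the end of the list.\<close>
  hence "set (vs @ [e]) \<subseteq> Basis" using assms by simp
  hence "foldr dir_deriv (vs @ [e]) f differentiable_on UNIV"
    using assms(1) unfolding C_infinity_def by blast
  thus "foldr dir_deriv vs (dir_deriv e f) differentiable_on UNIV" by simp
qed

lemma C_infinity_continuous: "C_infinity f \<Longrightarrow> continuous_on A f"
  using C_infinity_differentiable differentiable_imp_continuous_on continuous_on_subset by blast

lemma C_infinity_has_dir_deriv: "C_infinity f \<Longrightarrow> has_dir_deriv f (dir_deriv e f p) e p"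
  using C_infinity_differentiable by (intro differentiable_imp_has_dir_deriv) (auto simp: differentiable_on_def)

lemma C_infinity_dir_deriv_commute:
  assumes f: "C_infinity f" and ab: "a \<in> Basis" "b \<in> Basis"
  shows "dir_deriv b (dir_deriv a f) p = dir_deriv a (dir_deriv b f) p"
proof (rule mixed_dir_derivs_commute[where f = f and fa = "dir_deriv a f" and fb = "dir_deriv b f"
      and fab = "dir_deriv b (dir_deriv a f)" and fba = "dir_deriv a (dir_deriv b f)" and a = a and b = b])
  show "has_dir_deriv f (dir_deriv a f p) a p" "has_dir_deriv f (dir_deriv b f p) b p"
    "has_dir_deriv (dir_deriv a f) (dir_deriv b (dir_deriv a f) p) b p"
    "has_dir_deriv (dir_deriv b f) (dir_deriv a (dir_deriv b f) p) a p" for p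
    using assms by (auto intro: C_infinity_has_dir_deriv C_infinity_dir_deriv)
  have "continuous_on UNIV (dir_deriv b (dir_deriv a f))" "continuous_on UNIV (dir_deriv a (dir_deriv b f))"
    using assms by (auto intro!: C_infinity_continuous C_infinity_dir_deriv)
  thus "isCont (dir_deriv b (dir_deriv a f)) p" "isCont (dir_deriv a (dir_deriv b f)) p"
    by (auto simp: continuous_on_eq_continuous_at)
qed

lemma C_infinity_lip: "C_infinity f \<Longrightarrow> compact Q \<Longrightarrow> convex Q \<Longrightarrow> lip Q f"
  by (intro lip_C1 C_infinity_differentiable C_infinity_continuous C_infinity_dir_deriv)

text \<open>A closed ball times a closed time interval. It stays away from \<open>t = 0\<close>,
  where the weight is singular, and has the support in its interior, as the extension by zero
  requires.\<close>

lemma compact_subset_slab_box: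
  fixes S :: "((real^'n::finite) \<times> real) set"
  assumes "compact S" "S \<subseteq> slab"
  obtains Q a where "compact Q" "convex Q" "S \<subseteq> interior Q" "0 < a" "Q \<subseteq> UNIV \<times> {a..<2}"
proof -
  have comp: "compact (snd ` S)" "compact (fst ` S)"
    using assms(1) by (auto intro!: compact_continuous_image continuous_intros)
  have sub: "snd ` S \<subseteq> {0<..<2}" using assms(2) by (auto simp: slab_def)
  obtain a c where ac: "0 < a" "c < 2" "snd ` S \<subseteq> {a<..<c}"
  proof (cases "S = {}")
    case True
    thus ?thesis using that[of 1 1] by simp
  next
    case False
    obtain l where l: "l \<in> snd ` S" "\<And>y. y \<in> snd ` S \<Longrightarrow> l \<le> y"
      using compact_attains_inf[OF comp(1)] False by auto
    obtain m where m: "m \<in> snd ` S" "\<And>y. y \<in> snd ` S \<Longrightarrow> y \<le> m"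
      using compact_attains_sup[OF comp(1)] False by auto
    have "0 < l" "m < 2" using l(1) m(1) sub by auto
    moreover have "snd ` S \<subseteq> {l / 2<..<(m + 2) / 2}"
    proof
      fix y assume "y \<in> snd ` S"
      hence "l \<le> y" "y \<le> m" using l m by auto
      thus "y \<in> {l / 2<..<(m + 2) / 2}" using \<open>0 < l\<close> \<open>m < 2\<close> by auto
    qed
    ultimately show ?thesis using that[of "l / 2" "(m + 2) / 2"] by auto
  qed
  obtain R where R: "fst ` S \<subseteq> ball 0 R"
    using bounded_subset_ballD[OF compact_imp_bounded[OF comp(2)], of 0] by blast
  show ?thesis
  proof (rule that[of "cball 0 R \<times> {a..c}" a])
    show "S \<subseteq> interior (cball 0 R \<times> {a..c})"
      using R ac(3) by (auto simp: interior_Times subset_eq)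
  qed (use ac in \<open>auto intro!: compact_Times convex_Times\<close>)
qed

section \<open>Lipschitz continuity of the fields on a box\<close>

lemma lip_snd: "lip Q snd"
proof -
  have "1-lipschitz_on Q snd" by (rule lipschitz_onI) (auto simp: dist_snd_le)
  thus ?thesis by (auto simp: lip_def)
qed

lemma lip_fst_nth: "lip Q (\<lambda>p::(real^'n::finite) \<times> real. fst p $ i)"
proof -
  have "1-lipschitz_on Q (\<lambda>p::(real^'n) \<times> real. fst p $ i)"
  proof (rule lipschitz_onI)
    fix p q :: "(real^'n) \<times> real"
    show "dist (fst p $ i) (fst q $ i) \<le> 1 * dist p q"
      using dist_vec_nth_le[of "fst p" i "fst q"] dist_fst_le[of p q] by linarith
  qed simp
  thus ?thesis by (auto simp: lip_def)
qed

context carleman_fields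
begin

context
  fixes Q :: "((real^'n) \<times> real) set" and a :: real
  assumes Q: "compact Q" and a: "0 < a" and QS: "Q \<subseteq> UNIV \<times> {a..<2}"
begin

lemma lip_inverse_snd: "lip Q (\<lambda>p. 1 / snd p)"
proof (rule lip_compose_C1[OF lip_snd, of Q a 2 "\<lambda>y. 1 / y" "\<lambda>y. - (1 / y\<^sup>2)"])
  show "((/) 1 has_real_derivative - (1 / y\<^sup>2)) (at y)" if "y \<in> {a..2}" for y
    using that a by (auto intro!: derivative_eq_intros simp: power2_eq_square)
qed (use a QS in \<open>fastforce intro!: continuous_intros\<close>)+

lemma lip_powr_snd: "lip Q (\<lambda>p. snd p powr c)"
proof (rule lip_compose_C1[OF lip_snd, of Q a 2 "\<lambda>y. y powr c" "\<lambda>y. c * y powr (c - 1)"])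
  show "((\<lambda>y. y powr c) has_real_derivative c * y powr (c - 1)) (at y)" if "y \<in> {a..2}" for y
    using that a by (intro has_real_derivative_powr) auto
qed (use a QS in \<open>fastforce intro!: continuous_intros\<close>)+

lemma lip_norm_fst_sq: "lip Q (\<lambda>p. (norm (fst p))\<^sup>2)"
proof -
  have "(\<lambda>p::(real^'n) \<times> real. (norm (fst p))\<^sup>2) = (\<lambda>p. \<Sum>i\<in>UNIV. fst p $ i * fst p $ i)"
    by (simp add: norm_vec_def L2_set_def sum_nonneg power2_eq_square)
  thus ?thesis by (simp only:) (intro lip_sum lip_mult lip_fst_nth Q)
qed

lemma lip_phi: "lip Q phi"
  unfolding phi_def[abs_def] divide_inverse[of _ 2]
  by (intro lip_diff lip_mult lip_add lip_const lip_powr_snd lip_norm_fst_sq lip_inverse_snd Q)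

lemma lip_phix: "lip Q (phix i)"
  unfolding phix_def[abs_def] by (intro lip_mult lip_const lip_fst_nth lip_inverse_snd Q)

lemma lip_phit: "lip Q phit"
  unfolding phit_def[abs_def] divide_inverse[of _ 2]
  by (intro lip_mult lip_add lip_const lip_powr_snd lip_norm_fst_sq lip_inverse_snd Q)

lemma lip_om: "lip Q om"
proof -
  \<comment> \<open>\<open>exp\<close> is not globally Lipschitz, so the range of \<open>phi\<close>
    on \<open>Q\<close> is enclosed first.\<close>
  obtain B where "\<And>p. p \<in> Q \<Longrightarrow> \<bar>phi p\<bar> \<le> B" by (rule lip_bounded[OF Q lip_phi]) blast
  hence "p \<in> Q \<Longrightarrow> phi p \<in> {- B..B}" for p by (simp add: abs_le_iff minus_le_iff)
  thus ?thesis unfolding om_def[abs_def]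
    by (rule lip_compose_C1[OF lip_phi _ DERIV_exp]) (auto intro: continuous_intros)
qed

context
  assumes lip_A: "\<And>i j. lip Q (\<lambda>p. A p $ i $ j)"
    and lip_u: "lip Q u" "\<And>i. lip Q (d_x i u)" "lip Q (d_t u)"
begin

lemma lip_v: "lip Q v"
  unfolding v_def[abs_def] by (intro lip_mult lip_om lip_u Q)

lemma lip_vx: "lip Q (vx i)"
  unfolding vx_def[abs_def] by (intro lip_mult lip_add lip_om lip_phix lip_u Q)

lemma lip_vt: "lip Q vt"
  unfolding vt_def[abs_def] by (intro lip_mult lip_add lip_om lip_phit lip_u Q)

lemma lip_beta: "lip Q (beta i)"
  unfolding beta_def[abs_def] by (intro lip_sum lip_mult lip_A lip_phix Q)

lemma lip_q: "lip Q q"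
  unfolding q_def[abs_def] by (intro lip_sum lip_diff lip_mult lip_beta lip_phix lip_phit Q)

lemma lip_W: "lip Q (W i)"
  unfolding W_def[abs_def] by (intro lip_sum lip_mult lip_A lip_vx Q)

lemma lip_Av: "lip Q Av"
  unfolding Av_def[abs_def]
  by (intro lip_sum lip_diff lip_mult lip_const lip_beta lip_vx lip_vt lip_v lip_inverse_snd Q)

lemma lip_H: "lip Q H"
  unfolding H_def[abs_def] by (intro lip_sum lip_diff lip_mult lip_W lip_vx lip_q lip_v Q)

lemma lip_X: "lip Q (X i)"
  unfolding X_def[abs_def] by (intro lip_add lip_mult lip_const lip_W lip_Av lip_beta lip_H Q)

end

end

text \<open>\<open>H\<close> and \<open>X\<close> are quadratic in \<open>u\<close> and its first
  derivatives, so they vanish off the support of \<open>u\<close> whatever values \<open>A\<close>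
  takes there.\<close>

lemma fields_zero:
  assumes "u p = 0" "\<And>i. d_x i u p = 0" "d_t u p = 0"
  shows "H p = 0" "X i p = 0"
proof -
  have "v p = 0" "vx i p = 0" "vt p = 0" for i using assms by (auto simp: v_def vx_def vt_def)
  moreover from this have "W i p = 0" "Av p = 0" for i by (auto simp: W_def Av_def)
  ultimately show "H p = 0" "X i p = 0" by (auto simp: H_def X_def)
qed

lemma weight_eq: "carleman_weight b K \<gamma> p = (om p)\<^sup>2"
  by (cases p) (simp add: carleman_weight_def om_def phi_def power2_eq_square algebra_simps add_divide_distrib flip: exp_add)

end

section \<open>Integration of the pointwise inequality\<close>

lemma integrable_continuous_compact_support:
  fixes f :: "'a::euclidean_space \<Rightarrow> real"
  assumes "continuous_on UNIV f" "compact S" "\<And>p. p \<notin> S \<Longrightarrow> f p = 0"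
  shows "integrable lebesgue f"
proof -
  have "integrable lborel (\<lambda>p. indicator S p *\<^sub>R f p)"
    by (rule borel_integrable_compact[OF assms(2)]) (use assms(1) continuous_on_subset in blast)
  also have "(\<lambda>p. indicator S p *\<^sub>R f p) = f"
  proof
    show "indicator S p *\<^sub>R f p = f p" for p by (cases "p \<in> S") (auto simp: assms(3))
  qed
  finally show ?thesis by (simp add: integrable_completion borel_measurable_integrable)
qed

lemma axis_pair_in_Basis: "(axis i 1, 0) \<in> (Basis :: ((real^'n::finite) \<times> real) set)"
  by (auto simp: Basis_prod_def axis_in_Basis_iff)

lemma zero_one_in_Basis: "(0, 1) \<in> (Basis :: ((real^'n::finite) \<times> real) set)"
  by (auto simp: Basis_prod_def)

text \<open>The conditions on the constants involve neither \<open>A\<close> nor \<open>u\<close>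
  nor \<gamma>, so one choice serves them all. The pointwise inequality holds at almost every point,
  and the divergence integrates to zero.\<close>

theorem carleman_inequality:
  fixes A :: "(real^'n::finite) \<times> real \<Rightarrow> real^'n^'n" and lam Lam M E n b C1 C2 C3 C4 k1 K \<gamma> :: real
  assumes pos: "0 < lam" "lam \<le> Lam" "0 < M" "0 < E" "0 < \<gamma>"
    and const: "b = 1 / (8 * Lam)" "n = real CARD('n)"
      "C1 = b * (Lam + n * E)" "C2 = 2 * M + 2 * n\<^sup>2 * Lam * b * E"
      "C3 = 2 * n * C1 * Lam + 4 * n ^ 3 * Lam * C1 + n\<^sup>2 * C2"
      "C4 = 2 * n\<^sup>2 * Lam * b * (n * Lam * b + n * C1 + 1)"
    and k1_large: "C3 + 4 \<le> 2 * k1 * lam" "n * C1 + 2 \<le> k1"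
      "4 * b \<le> 3 * k1 / 4 - 1 - 2 * n\<^sup>2 * M * b - C4 - n * C1"
    and K_large: "8 + 2 * (k1 + n * C1)\<^sup>2 \<le> K" "2 * k1 + 2 * (n * C1) \<le> K + 1"
    and sym: "\<forall>p\<in>slab. transpose (A p) = A p"
    and ell: "uniformly_elliptic lam Lam A"
    and coeff: "coeff_derivative_bounds M E A"
    and u: "u \<in> C0_infinity slab"
  shows "set_lebesgue_integral lebesgue slab
         (\<lambda>p. carleman_weight b K \<gamma> p * (\<bar>u p\<bar>\<^sup>2 + (norm (grad_x u p))\<^sup>2))
       \<le> set_lebesgue_integral lebesgue slab
         (\<lambda>p. carleman_weight b K \<gamma> p * \<bar>parabolic_op A u p\<bar>\<^sup>2)"
proof -
  interpret F: carleman_fields A u b K \<gamma> k1 .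
  define S where "S = closure (support_on UNIV u)"
  have uC: "C_infinity u" and S: "compact S" "S \<subseteq> slab" using u by (auto simp: C0_infinity_def S_def)
  have u0: "u p = 0" if "p \<notin> S" for p
    using that closure_subset[of "support_on UNIV u"] by (auto simp: S_def support_on_def)
  have du0: "dir_deriv e u p = 0" if "p \<notin> S" for p e
    using has_dir_deriv_local_zero[OF compact_imp_closed[OF S(1)] that u0] by (rule dir_deriv_eqI)
  have H0: "F.H p = 0" and X0: "F.X i p = 0" if "p \<notin> S" for p i
    using F.fields_zero[of p] u0[OF that] du0[OF that] by (auto simp: d_x_def d_t_def)
  obtain Q a where Q: "compact Q" "convex Q" "S \<subseteq> interior Q" and a: "0 < a" and QS: "Q \<subseteq> UNIV \<times> {a..<2}"
    using compact_subset_slab_box[OF S] .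
  have Qslab: "Q \<subseteq> slab" using QS a by (auto simp: slab_def)
  have SQ: "S \<subseteq> Q" using Q(3) interior_subset by blast
  have lip_A: "lip Q (\<lambda>p. A p $ i $ j)" for i j
    using coeff lipschitz_on_subset[OF _ Qslab] unfolding coeff_derivative_bounds_def lip_def by blast
  have lip_u: "lip Q u" "lip Q (d_x i u)" "lip Q (d_t u)" for i
    using uC Q by (auto simp: d_x_def d_t_def intro!: C_infinity_lip C_infinity_dir_deriv
        axis_pair_in_Basis zero_one_in_Basis)
  note lips = Q(1) a QS lip_A lip_u

  \<comment> \<open>The points at which the almost everywhere bounds hold for all entries at once;
    there \<open>carleman_bounds\<close> can be interpreted.\<close>
  define good where "good p \<longleftrightarrow> (\<forall>i j. (\<lambda>q. A q $ i $ j) differentiable (at p) \<and>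
      norm (grad_x (\<lambda>q. A q $ i $ j) p) + \<bar>d_t (\<lambda>q. A q $ i $ j) p\<bar> \<le> M \<and>
      norm (grad_x (\<lambda>q. A q $ i $ j) p) \<le> E / norm (fst p))" for p
  have good: "AE p in lebesgue. p \<in> slab \<longrightarrow> good p"
  proof -
    have "AE p in lebesgue. \<forall>i\<in>UNIV. \<forall>j\<in>UNIV. p \<in> slab \<longrightarrow> (\<lambda>q. A q $ i $ j) differentiable (at p) \<and>
      norm (grad_x (\<lambda>q. A q $ i $ j) p) + \<bar>d_t (\<lambda>q. A q $ i $ j) p\<bar> \<le> M \<and>
      norm (grad_x (\<lambda>q. A q $ i $ j) p) \<le> E / norm (fst p)"
      using coeff unfolding coeff_derivative_bounds_def by (intro AE_finite_allI) auto
    thus ?thesis by eventually_elim (auto simp: good_def)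
  qed

  have bounds: "carleman_bounds A u b K \<gamma> k1 p (\<lambda>k i j. d_x k (\<lambda>q. A q $ i $ j) p)
      (\<lambda>i j. d_t (\<lambda>q. A q $ i $ j) p) (\<lambda>k i. d_x k (d_x i u) p) (\<lambda>i. d_t (d_x i u) p)
      lam Lam M E n C1 C2 C3 C4" if p: "p \<in> slab" "good p" for p
  proof (unfold_locales; (rule pos const k1_large K_large)?)
    show "0 < snd p" "snd p < 2" using p(1) by (auto simp: slab_def)
    fix i j k :: 'n
    have "transpose (A p) $ i $ j = A p $ i $ j" using sym p(1) by simp
    thus "A p $ i $ j = A p $ j $ i" by (simp add: transpose_def)
    have diff: "(\<lambda>q. A q $ i $ j) differentiable (at p)" using p(2) by (auto simp: good_def)
    show "has_dir_deriv (\<lambda>p. A p $ i $ j) (d_x k (\<lambda>q. A q $ i $ j) p) (axis k 1, 0) p"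
      "has_dir_deriv (\<lambda>p. A p $ i $ j) (d_t (\<lambda>q. A q $ i $ j) p) (0, 1) p"
      unfolding d_x_def d_t_def by (rule differentiable_imp_has_dir_deriv[OF diff])+
    show "has_dir_deriv u (d_x i u p) (axis i 1, 0) p" "has_dir_deriv u (d_t u p) (0, 1) p"
      "has_dir_deriv (d_x i u) (d_x k (d_x i u) p) (axis k 1, 0) p"
      "has_dir_deriv (d_x i u) (d_t (d_x i u) p) (0, 1) p"
      unfolding d_x_def d_t_def
      by (intro C_infinity_has_dir_deriv C_infinity_dir_deriv axis_pair_in_Basis uC)+
    have "d_t (d_x i u) p = dir_deriv (axis i 1, 0) (d_t u) p"
      unfolding d_x_def d_t_def
      by (rule C_infinity_dir_deriv_commute[OF uC axis_pair_in_Basis zero_one_in_Basis])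
    thus "has_dir_deriv (d_t u) (d_t (d_x i u) p) (axis i 1, 0) p"
      using C_infinity_has_dir_deriv[OF C_infinity_dir_deriv[OF uC zero_one_in_Basis]]
      by (simp add: d_t_def)
    show "d_x i (d_x k u) p = d_x k (d_x i u) p"
      unfolding d_x_def
      by (rule C_infinity_dir_deriv_commute[OF uC axis_pair_in_Basis axis_pair_in_Basis])
    have comp: "\<bar>d_x k (\<lambda>q. A q $ i $ j) p\<bar> \<le> norm (grad_x (\<lambda>q. A q $ i $ j) p)"
      using component_le_norm_cart[of "grad_x (\<lambda>q. A q $ i $ j) p" k] by (simp add: grad_x_def)
    show "\<bar>d_t (\<lambda>q. A q $ i $ j) p\<bar> \<le> M"
    proof -
      have "norm (grad_x (\<lambda>q. A q $ i $ j) p) + \<bar>d_t (\<lambda>q. A q $ i $ j) p\<bar> \<le> M"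
        using p(2) by (auto simp: good_def)
      thus ?thesis using norm_ge_zero[of "grad_x (\<lambda>q. A q $ i $ j) p"] by linarith
    qed
    show "\<bar>d_x k (\<lambda>q. A q $ i $ j) p\<bar> * norm (fst p) \<le> E"
    \<comment> \<open>At \<open>x = 0\<close> the product is 0, so the convention for
      \<open>E / 0\<close> is harmless.\<close>
    proof (cases "fst p = 0")
      case False
      have "\<bar>d_x k (\<lambda>q. A q $ i $ j) p\<bar> \<le> E / norm (fst p)"
        using comp p(2) unfolding good_def by (meson order_trans)
      thus ?thesis using False by (simp add: field_simps)
    qed (use pos in simp)
  next
    fix \<xi> :: "real^'n"
    show "lam * (norm \<xi>)\<^sup>2 \<le> (\<Sum>i\<in>UNIV. \<Sum>j\<in>UNIV. A p $ i $ j * \<xi> $ i * \<xi> $ j)"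
      "(\<Sum>i\<in>UNIV. \<Sum>j\<in>UNIV. A p $ i $ j * \<xi> $ i * \<xi> $ j) \<le> Lam * (norm \<xi>)\<^sup>2"
      using ell p(1) by (auto simp: uniformly_elliptic_def)
  qed

  have DX: "\<exists>D. has_dir_deriv (F.X i) D (axis i 1, 0) p" and DH: "\<exists>D. has_dir_deriv F.H D (0, 1) p"
    if "p \<in> slab" "good p" for p i
  proof -
    interpret B: carleman_bounds A u b K \<gamma> k1 p "\<lambda>k i j. d_x k (\<lambda>q. A q $ i $ j) p"
      "\<lambda>i j. d_t (\<lambda>q. A q $ i $ j) p" "\<lambda>k i. d_x k (d_x i u) p" "\<lambda>i. d_t (d_x i u) p"
      lam Lam M E n C1 C2 C3 C4 using that by (rule bounds)
    show "\<exists>D. has_dir_deriv (F.X i) D (axis i 1, 0) p" "\<exists>D. has_dir_deriv F.H D (0, 1) p"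
      using B.has_dir_deriv_X B.has_dir_deriv_H_t by blast+
  qed

  \<comment> \<open>The space-time divergence of \<open>(X, - H)\<close>.\<close>
  define DIV where "DIV p = (\<Sum>i\<in>UNIV. dir_deriv (axis i 1, 0) (F.X i) p) - dir_deriv (0, 1) F.H p" for p
  have ptw: "(F.om p)\<^sup>2 * ((u p)\<^sup>2 + (\<Sum>i\<in>UNIV. (d_x i u p)\<^sup>2)) + DIV p \<le> (F.om p * parabolic_op A u p)\<^sup>2"
    if "p \<in> slab" "good p" for p
  proof -
    interpret B: carleman_bounds A u b K \<gamma> k1 p "\<lambda>k i j. d_x k (\<lambda>q. A q $ i $ j) p"
      "\<lambda>i j. d_t (\<lambda>q. A q $ i $ j) p" "\<lambda>k i. d_x k (d_x i u) p" "\<lambda>i. d_t (d_x i u) p"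
      lam Lam M E n C1 C2 C3 C4 using that by (rule bounds)
    show ?thesis
      using B.pointwise_carleman
      unfolding DIV_def dir_deriv_eqI[OF B.has_dir_deriv_X] dir_deriv_eqI[OF B.has_dir_deriv_H_t] .
  qed

  have lip_UNIV: "\<exists>L. L-lipschitz_on UNIV w" if "lip Q w" "\<And>p. p \<notin> S \<Longrightarrow> w p = 0" for w
    using that lipschitz_on_UNIV_if_zero_outside[OF _ compact_imp_closed[OF Q(1)] Q(3)]
    unfolding lip_def by blast
  \<comment> \<open>The essential bound is kept along with the vanishing integral: it later makes
    \<open>P u\<close> bounded and \<open>F2\<close> integrable.\<close>
  have ibp: "integrable lebesgue (dir_deriv e w) \<and> (\<integral>p. dir_deriv e w p \<partial>lebesgue) = 0 \<and>
      (\<exists>B. AE p in lebesgue. \<bar>dir_deriv e w p\<bar> \<le> B)"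
    if w: "lip Q w" "\<And>p. p \<notin> S \<Longrightarrow> w p = 0"
      and D: "\<And>p. p \<in> slab \<Longrightarrow> good p \<Longrightarrow> \<exists>D. has_dir_deriv w D e p" for w e
  proof -
    obtain L where L: "L-lipschitz_on UNIV w" using lip_UNIV[OF w] by blast
    have ae: "AE p in lebesgue. p \<in> S \<longrightarrow> (\<exists>D. has_dir_deriv w D e p)"
      using good by eventually_elim (use D S(2) in blast)
    show ?thesis
      using lipschitz_compact_support_dir_deriv[OF L S(1) w(2) ae] by blast
  qed

  have iX: "integrable lebesgue (dir_deriv (axis i 1, 0) (F.X i))"
    "(\<integral>p. dir_deriv (axis i 1, 0) (F.X i) p \<partial>lebesgue) = 0" for i
    using ibp[OF F.lip_X[OF lips] X0 DX] by auto
  have iH: "integrable lebesgue (dir_deriv (0, 1) F.H)" "(\<integral>p. dir_deriv (0, 1) F.H p \<partial>lebesgue) = 0"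
    using ibp[OF F.lip_H[OF lips] H0 DH] by auto
  have iDIV: "integrable lebesgue DIV" "(\<integral>p. DIV p \<partial>lebesgue) = 0"
    unfolding DIV_def[abs_def] using iX iH
    by (auto intro!: Bochner_Integration.integrable_diff Bochner_Integration.integrable_sum)
  have DIV0: "DIV p = 0" if "p \<notin> S" for p
    using dir_deriv_eqI[OF has_dir_deriv_local_zero[OF compact_imp_closed[OF S(1)] that X0]]
      dir_deriv_eqI[OF has_dir_deriv_local_zero[OF compact_imp_closed[OF S(1)] that H0]]
    by (simp add: DIV_def)

  define F1 where "F1 p = (F.om p)\<^sup>2 * ((u p)\<^sup>2 + (\<Sum>i\<in>UNIV. (d_x i u p)\<^sup>2))" for p
  define F2 where "F2 p = (F.om p * parabolic_op A u p)\<^sup>2" for p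
  have F10: "F1 p = 0" if "p \<notin> S" for p
    using u0[OF that] du0[OF that] by (simp add: F1_def d_x_def)
  have P_eq: "parabolic_op A u p = d_t u p
      + (\<Sum>i\<in>UNIV. \<Sum>j\<in>UNIV. dir_deriv (axis i 1, 0) (\<lambda>q. A q $ i $ j * d_x j u q) p)" for p
    by (simp add: parabolic_op_def d_x_def)
  have P0: "parabolic_op A u p = 0" if "p \<notin> S" for p
  proof -
    \<comment> \<open>\<open>A\<close> is arbitrary outside the slab, but its product with a
      derivative of \<open>u\<close> vanishes near \<open>p\<close>.\<close>
    have "dir_deriv (axis i 1, 0) (\<lambda>q. A q $ i $ j * d_x j u q) p = 0" for i j
      by (rule dir_deriv_eqI, rule has_dir_deriv_local_zero[OF compact_imp_closed[OF S(1)] that])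
        (simp add: d_x_def du0)
    thus ?thesis using du0[OF that] by (simp add: P_eq d_t_def)
  qed

  have iF1: "integrable lebesgue F1"
  proof (rule integrable_continuous_compact_support[OF _ S(1) F10])
    have "lip Q F1" unfolding F1_def[abs_def] power2_eq_square
      by (intro lip_mult lip_add lip_sum F.lip_om[OF Q(1) a QS] lip_u Q)
    then obtain L where "L-lipschitz_on UNIV F1" using lip_UNIV F10 by blast
    thus "continuous_on UNIV F1" by (rule lipschitz_on_continuous_on)
  qed
  \<comment> \<open>\<open>P u\<close> contains derivatives of \<open>A\<close>, known only to be
    measurable and essentially bounded, so \<open>F2\<close> is dominated by a constant on
    \<open>Q\<close> instead of being treated as continuous.\<close>
  have iF2: "integrable lebesgue F2"
  proof -
    have w: "lip Q (\<lambda>q. A q $ i $ j * d_x j u q)" for i j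
      by (intro lip_mult lip_A lip_u Q)
    have w0: "A p $ i $ j * d_x j u p = 0" if "p \<notin> S" for p i j
      using du0[OF that] by (simp add: d_x_def)
    have wD: "\<exists>D. has_dir_deriv (\<lambda>q. A q $ i $ j * d_x j u q) D (axis i 1, 0) p"
      if "p \<in> slab" "good p" for p i j
    proof -
      have "has_dir_deriv (\<lambda>q. A q $ i $ j) (dir_deriv (axis i 1, 0) (\<lambda>q. A q $ i $ j) p) (axis i 1, 0) p"
        using that(2) by (intro differentiable_imp_has_dir_deriv) (auto simp: good_def)
      from has_dir_deriv_mult[OF this C_infinity_has_dir_deriv[OF C_infinity_dir_deriv[OF uC axis_pair_in_Basis]]]
      show ?thesis unfolding d_x_def by blast
    qed
    have wi: "integrable lebesgue (dir_deriv (axis i 1, 0) (\<lambda>q. A q $ i $ j * d_x j u q))"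
        "\<exists>C. AE p in lebesgue. \<bar>dir_deriv (axis i 1, 0) (\<lambda>q. A q $ i $ j * d_x j u q) p\<bar> \<le> C" for i j
      using ibp[OF w w0 wD, of i j] by blast+
    obtain L where L: "L-lipschitz_on UNIV (d_t u)"
      using lip_UNIV[OF lip_u(3)] du0 by (auto simp: d_t_def)
    have mt: "d_t u \<in> borel_measurable lebesgue"
      using lipschitz_on_continuous_on[OF L]
      by (intro measurable_completion) (auto intro: borel_measurable_continuous_onI)
    have mP: "parabolic_op A u \<in> borel_measurable lebesgue"
      unfolding P_eq[abs_def]
      by (intro borel_measurable_add borel_measurable_sum mt borel_measurable_integrable wi(1))
    obtain B0 where B0: "\<And>p. p \<in> Q \<Longrightarrow> \<bar>d_t u p\<bar> \<le> B0" by (rule lip_bounded[OF Q(1) lip_u(3)]) blast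
    obtain B1 where B1: "\<And>p. p \<in> Q \<Longrightarrow> \<bar>F.om p\<bar> \<le> B1"
      by (rule lip_bounded[OF Q(1) F.lip_om[OF Q(1) a QS]]) blast
    \<comment> \<open>A choice of bounds as a function of \<open>i\<close> and \<open>j\<close>, so
      that they can be summed.\<close>
    define B2 where "B2 i j = (SOME C. AE p in lebesgue.
        \<bar>dir_deriv (axis i 1, 0) (\<lambda>q. A q $ i $ j * d_x j u q) p\<bar> \<le> C)" for i j
    have B2: "AE p in lebesgue.
        \<bar>dir_deriv (axis i 1, 0) (\<lambda>q. A q $ i $ j * d_x j u q) p\<bar> \<le> B2 i j" for i j
      unfolding B2_def by (rule someI_ex) (rule wi(2))
    define B where "B = B0 + (\<Sum>i\<in>UNIV. \<Sum>j\<in>UNIV. B2 i j)"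
    have "AE p in lebesgue. \<forall>i\<in>UNIV. \<forall>j\<in>UNIV.
        \<bar>dir_deriv (axis i 1, 0) (\<lambda>q. A q $ i $ j * d_x j u q) p\<bar> \<le> B2 i j"
      using B2 by (intro AE_finite_allI) auto
    hence AE_B: "AE p in lebesgue. p \<in> Q \<longrightarrow> \<bar>parabolic_op A u p\<bar> \<le> B"
    proof eventually_elim
      case (elim p)
      have "\<bar>\<Sum>i\<in>UNIV. \<Sum>j\<in>UNIV. dir_deriv (axis i 1, 0) (\<lambda>q. A q $ i $ j * d_x j u q) p\<bar>
          \<le> (\<Sum>i\<in>UNIV. \<Sum>j\<in>UNIV. B2 i j)"
        unfolding real_norm_def[symmetric] by (intro sum_norm_le) (use elim in auto)
      thus ?case using B0[of p] unfolding P_eq B_def by (auto intro: order_trans[OF abs_triangle_ineq])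
    qed
    \<comment> \<open>The indicator confines \<open>om\<close> to the box where it is continuous;
      \<open>F2\<close> keeps its values because \<open>P u\<close> vanishes outside
      \<open>S\<close>.\<close>
    have mo: "(\<lambda>p. indicator Q p *\<^sub>R F.om p) \<in> borel_measurable lebesgue"
    proof (rule measurable_completion)
      have "(\<lambda>p. indicator Q p *\<^sub>R F.om p) \<in> borel_measurable borel"
        using compact_imp_closed[OF Q(1)] lip_imp_continuous_on[OF F.lip_om[OF Q(1) a QS]]
        by (intro borel_measurable_continuous_on_indicator borel_closed)
      thus "(\<lambda>p. indicator Q p *\<^sub>R F.om p) \<in> borel_measurable lborel" by simp
    qed
    have F2_eq: "F2 p = (indicator Q p *\<^sub>R F.om p * parabolic_op A u p)\<^sup>2" for p
      using P0[of p] SQ by (cases "p \<in> Q") (auto simp: F2_def)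
    have iQ: "integrable lebesgue (\<lambda>p. (B1 * B)\<^sup>2 * indicat_real Q p)"
    proof -
      have "Q \<in> lmeasurable" using Q(1) by (rule lmeasurable_compact)
      thus ?thesis by (intro integrable_mult_right integrable_real_indicator) (auto simp: fmeasurable_def)
    qed
    show ?thesis
    proof (rule Bochner_Integration.integrable_bound[OF iQ])
      show "F2 \<in> borel_measurable lebesgue"
        unfolding F2_eq[abs_def] by (intro borel_measurable_power borel_measurable_times mo mP)
      show "AE p in lebesgue. norm (F2 p) \<le> norm ((B1 * B)\<^sup>2 * indicat_real Q p)"
        using AE_B
      proof eventually_elim
        case (elim p)
        show ?case
        proof (cases "p \<in> Q")
          case True
          hence "\<bar>F.om p * parabolic_op A u p\<bar> \<le> B1 * B"
            unfolding abs_mult using B1[OF True] elim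
            by (intro mult_mono) (auto intro: order_trans[OF abs_ge_zero])
          hence "(F.om p * parabolic_op A u p)\<^sup>2 \<le> (B1 * B)\<^sup>2"
            by (metis abs_ge_zero order_trans power2_abs power_mono)
          thus ?thesis using True by (simp add: F2_def)
        next
          case False
          thus ?thesis by (simp add: F2_eq)
        qed
      qed
    qed
  qed

  \<comment> \<open>In the slab this is the pointwise inequality; outside it the left side is 0 and
    the right side a square.\<close>
  have "AE p in lebesgue. F1 p + DIV p \<le> F2 p"
    using good
  proof eventually_elim
    case (elim p)
    show ?case
    proof (cases "p \<in> slab")
      case True
      thus ?thesis using ptw elim by (simp add: F1_def F2_def)
    next
      case False
      hence "p \<notin> S" using S(2) by blast
      thus ?thesis by (simp add: F10 DIV0 F2_def)
    qed
  qed
  hence "(\<integral>p. F1 p + DIV p \<partial>lebesgue) \<le> (\<integral>p. F2 p \<partial>lebesgue)"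
    by (intro integral_mono_AE Bochner_Integration.integrable_add iF1 iDIV iF2)
  hence "(\<integral>p. F1 p \<partial>lebesgue) \<le> (\<integral>p. F2 p \<partial>lebesgue)"
    using iF1 iDIV by simp
  moreover have "indicator slab p *\<^sub>R (carleman_weight b K \<gamma> p * (\<bar>u p\<bar>\<^sup>2 + (norm (grad_x u p))\<^sup>2)) = F1 p" for p
  proof (cases "p \<in> slab")
    case True
    have "(norm (grad_x u p))\<^sup>2 = (\<Sum>i\<in>UNIV. (d_x i u p)\<^sup>2)"
      by (simp add: grad_x_def norm_vec_def L2_set_def sum_nonneg)
    thus ?thesis using True by (simp add: F1_def F.weight_eq)
  qed (use F10[of p] S(2) in auto)
  moreover have "indicator slab p *\<^sub>R (carleman_weight b K \<gamma> p * \<bar>parabolic_op A u p\<bar>\<^sup>2) = F2 p" for p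
  proof (cases "p \<in> slab")
    case True
    thus ?thesis by (simp add: F2_def F.weight_eq power_mult_distrib)
  qed (use P0[of p] S(2) in \<open>auto simp: F2_def\<close>)
  ultimately show ?thesis by (simp add: set_lebesgue_integral_def)
qed

section \<open>Choice of the constants\<close>

theorem proposition1p3:
  fixes lam Lam M E :: real
  assumes "0 < lam" and "lam \<le> Lam" and "0 < M" and "0 < E"
  shows "\<exists>K>0. \<forall>A :: (real^'n::finite) \<times> real \<Rightarrow> real^'n^'n.
    (\<forall>p\<in>slab. transpose (A p) = A p) \<longrightarrow>
    uniformly_elliptic lam Lam A \<longrightarrow>
    coeff_derivative_bounds M E A \<longrightarrow>
    (\<forall>u \<in> C0_infinity slab. \<forall>\<gamma>>0.
       set_lebesgue_integral lebesgue slab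
         (\<lambda>p. carleman_weight (1 / (8 * Lam)) K \<gamma> p * (\<bar>u p\<bar>\<^sup>2 + (norm (grad_x u p))\<^sup>2))
       \<le> set_lebesgue_integral lebesgue slab
         (\<lambda>p. carleman_weight (1 / (8 * Lam)) K \<gamma> p * \<bar>parabolic_op A u p\<bar>\<^sup>2))"
proof -
  define b where "b = 1 / (8 * Lam)"
  define n where "n = real CARD('n)"
  define C1 where "C1 = b * (Lam + n * E)"
  define C2 where "C2 = 2 * M + 2 * n\<^sup>2 * Lam * b * E"
  define C3 where "C3 = 2 * n * C1 * Lam + 4 * n ^ 3 * Lam * C1 + n\<^sup>2 * C2"
  define C4 where "C4 = 2 * n\<^sup>2 * Lam * b * (n * Lam * b + n * C1 + 1)"
  note constants = b_def n_def C1_def C2_def C3_def C4_def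
  \<comment> \<open>\<open>c\<close> gathers what the scale \<open>r / t\<close> demands of
    \<open>3 * k1 / 4\<close>; \<open>k1\<close> is the largest of three lower bounds, and
    \<open>K\<close>, chosen last, is a sum that dominates both of its own. All of them depend on
    the dimension, \<open>lam\<close>, \<open>Lam\<close>, \<open>M\<close> and \<open>E\<close>
    only.\<close>
  define c where "c = 4 * b + 1 + 2 * n\<^sup>2 * M * b + C4 + n * C1"
  define k1 where "k1 = max ((C3 + 4) / (2 * lam)) (max (n * C1 + 2) (4 / 3 * c))"
  define K where "K = 8 + 2 * (k1 + n * C1)\<^sup>2 + 2 * k1 + 2 * (n * C1)"
  have "0 \<le> n * C1" using assms by (simp add: n_def C1_def b_def)
  have "(C3 + 4) / (2 * lam) \<le> k1" by (simp add: k1_def)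
  hence k1: "C3 + 4 \<le> 2 * k1 * lam" using assms by (simp add: field_simps)
  have k2: "n * C1 + 2 \<le> k1" by (simp add: k1_def)
  have "4 / 3 * c \<le> k1" unfolding k1_def by (intro max.coboundedI2 max.cobounded2)
  hence "c \<le> 3 * k1 / 4" by simp
  hence k3: "4 * b \<le> 3 * k1 / 4 - 1 - 2 * n\<^sup>2 * M * b - C4 - n * C1" unfolding c_def by linarith
  have K: "8 + 2 * (k1 + n * C1)\<^sup>2 \<le> K" "2 * k1 + 2 * (n * C1) \<le> K + 1"
    using \<open>0 \<le> n * C1\<close> k2 zero_le_power2[of "k1 + n * C1"] unfolding K_def by linarith+
  have "0 < K" using K(1) zero_le_power2[of "k1 + n * C1"] by linarith
  show ?thesis
    using \<open>0 < K\<close> carleman_inequality[OF assms _ constants k1 k2 k3 K] unfolding b_def by blast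
qed

end
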